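(* There exist an integer $n\ge2$ and a $1$-point QDP in $\mathbb{C}^n$ which is not the biholomorphic image of a circular domain in $\mathbb{C}^n$ under a biholomorphic map with constant complex Jacobian determinant.
   Context: A domain is a nonempty connected open set. A domain $\Omega\subset\mathbb{C}^n$ is circular if $kz\in\Omega$ whenever $z\in\Omega$, $k\in\mathbb{C}$, $|k|=1$. For a domain $\Omega\subset\mathbb{C}^n$, $H^2(\Omega)$ is the Bergman space of holomorphic functions on $\Omega$ square-integrable with respect to Lebesgue measure, and $K(z,w)$ is its Bergman kernel: holomorphic in $z$, antiholomorphic in $w$, with $\int_\Omega f(w)K(z,w)\,dV(w)=f(z)$ for all $f\in H^2(\Omega)$. For $w_0\in\Omega$, the Bergman span at $w_0$ is the complex linear span of the functions $z\mapsto\frac{\partial^\alpha}{\partial\bar w^\alpha}K(z,w)|_{w=w_0}$, with $\alpha$ varying over multi-indices and $w_0$ held fixed. A domain $\Omega$ is a $1$-point QDP if there exists a point $w_0\in\Omega$ such that every holomorphic polynomial (restricted to $\Omega$) is contained in the Bergman span at $w_0$. *)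

theory Defs
  imports "HOL-Complex_Analysis.Complex_Analysis" "Jordan_Normal_Form.Determinant"
begin

(* The dimension n is existentially quantified in the theorem, so C^n cannot be a type indexed
   by a finite type.  Points of C^n are the functions nat => complex that are extensional on
   {..<n}; this matches the product topology and the product measure of the library. *)

type_synonym cpoint = "nat \<Rightarrow> complex"

definition Cn_top :: "nat \<Rightarrow> cpoint topology" where
  "Cn_top n = product_topology (\<lambda>_. euclidean) {..<n}"

definition Cn_lborel :: "nat \<Rightarrow> cpoint measure" where
  "Cn_lborel n = PiM {..<n} (\<lambda>_. lborel)"

definition Cn_domain :: "nat \<Rightarrow> cpoint set \<Rightarrow> bool" where
  "Cn_domain n \<Omega> \<longleftrightarrow> \<Omega> \<noteq> {} \<and> openin (Cn_top n) \<Omega> \<and> connectedin (Cn_top n) \<Omega>"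

definition circular :: "nat \<Rightarrow> cpoint set \<Rightarrow> bool" where
  "circular n \<Omega> \<longleftrightarrow> (\<forall>z\<in>\<Omega>. \<forall>k. cmod k = 1 \<longrightarrow> (\<lambda>i\<in>{..<n}. k * z i) \<in> \<Omega>)"

(* Complex Frechet differentiability, with derivative h |-> (SUM i<n. L i * h i). *)
definition Cn_differentiable :: "nat \<Rightarrow> (cpoint \<Rightarrow> complex) \<Rightarrow> cpoint \<Rightarrow> bool" where
  "Cn_differentiable n f z \<longleftrightarrow>
     (\<exists>L. ((\<lambda>w. (f w - f z - (\<Sum>i<n. L i * (w i - z i))) /
                of_real (L2_set (\<lambda>i. cmod (w i - z i)) {..<n})) \<longlongrightarrow> 0) (atin (Cn_top n) z))"

definition Cn_holomorphic :: "nat \<Rightarrow> cpoint set \<Rightarrow> (cpoint \<Rightarrow> complex) \<Rightarrow> bool" where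
  "Cn_holomorphic n \<Omega> f \<longleftrightarrow> (\<forall>z\<in>\<Omega>. Cn_differentiable n f z)"

(* Functions on \<Omega> are represented by functions on the whole type whose values outside \<Omega>
   are irrelevant; this also applies to the kernel and the span below. *)
definition bergman_space :: "nat \<Rightarrow> cpoint set \<Rightarrow> (cpoint \<Rightarrow> complex) set" where
  "bergman_space n \<Omega> =
     {f. Cn_holomorphic n \<Omega> f \<and> set_integrable (Cn_lborel n) \<Omega> (\<lambda>z. (cmod (f z))\<^sup>2)}"

(* Membership of cnj (K z _) in the Bergman space makes the kernel unique on \<Omega> \<times> \<Omega>, and
   makes the reproducing integrals absolutely convergent. *)
definition is_bergman_kernel ::
    "nat \<Rightarrow> cpoint set \<Rightarrow> (cpoint \<Rightarrow> cpoint \<Rightarrow> complex) \<Rightarrow> bool" where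
  "is_bergman_kernel n \<Omega> K \<longleftrightarrow>
     (\<forall>w\<in>\<Omega>. Cn_holomorphic n \<Omega> (\<lambda>z. K z w)) \<and>
     (\<forall>z\<in>\<Omega>. (\<lambda>w. cnj (K z w)) \<in> bergman_space n \<Omega>) \<and>
     (\<forall>f\<in>bergman_space n \<Omega>. \<forall>z\<in>\<Omega>.
        set_lebesgue_integral (Cn_lborel n) \<Omega> (\<lambda>w. f w * K z w) = f z)"

(* The Wirtinger operator d/d(cnj w_j) = (d/dx_j + i d/dy_j) / 2, where w_j = x_j + i y_j. *)
definition dbar :: "nat \<Rightarrow> (cpoint \<Rightarrow> complex) \<Rightarrow> cpoint \<Rightarrow> complex" where
  "dbar j g w =
     (vector_derivative (\<lambda>t. g (w(j := w j + of_real t))) (at 0) +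
      \<i> * vector_derivative (\<lambda>t. g (w(j := w j + \<i> * of_real t))) (at 0)) / 2"

primrec dbar_multi :: "nat \<Rightarrow> (nat \<Rightarrow> nat) \<Rightarrow> (cpoint \<Rightarrow> complex) \<Rightarrow> cpoint \<Rightarrow> complex" where
  "dbar_multi 0 \<alpha> g = g"
| "dbar_multi (Suc m) \<alpha> g = dbar_multi m \<alpha> ((dbar m ^^ \<alpha> m) g)"

definition multi_indices :: "nat \<Rightarrow> (nat \<Rightarrow> nat) set" where
  "multi_indices n = {..<n} \<rightarrow>\<^sub>E UNIV"

definition bergman_span ::
    "nat \<Rightarrow> cpoint set \<Rightarrow> (cpoint \<Rightarrow> cpoint \<Rightarrow> complex) \<Rightarrow> cpoint \<Rightarrow> (cpoint \<Rightarrow> complex) set" where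
  "bergman_span n \<Omega> K w0 =
     {f. \<exists>A c. finite A \<and> A \<subseteq> multi_indices n \<and>
           (\<forall>z\<in>\<Omega>. f z = (\<Sum>\<alpha>\<in>A. c \<alpha> * dbar_multi n \<alpha> (\<lambda>w. K z w) w0))}"

definition holomorphic_polynomials :: "nat \<Rightarrow> (cpoint \<Rightarrow> complex) set" where
  "holomorphic_polynomials n =
     {p. \<exists>A c. finite A \<and> A \<subseteq> multi_indices n \<and>
           (\<forall>z\<in>topspace (Cn_top n). p z = (\<Sum>\<alpha>\<in>A. c \<alpha> * (\<Prod>i<n. z i ^ \<alpha> i)))}"

definition one_point_QDP :: "nat \<Rightarrow> cpoint set \<Rightarrow> bool" where
  "one_point_QDP n \<Omega> \<longleftrightarrow> Cn_domain n \<Omega> \<and>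
     (\<exists>K. is_bergman_kernel n \<Omega> K \<and>
        (\<exists>w0\<in>\<Omega>. holomorphic_polynomials n \<subseteq> bergman_span n \<Omega> K w0))"

definition Cn_holomorphic_map :: "nat \<Rightarrow> cpoint set \<Rightarrow> (cpoint \<Rightarrow> cpoint) \<Rightarrow> bool" where
  "Cn_holomorphic_map n D F \<longleftrightarrow> (\<forall>i<n. Cn_holomorphic n D (\<lambda>z. F z i))"

definition biholomorphic_map ::
    "nat \<Rightarrow> cpoint set \<Rightarrow> cpoint set \<Rightarrow> (cpoint \<Rightarrow> cpoint) \<Rightarrow> bool" where
  "biholomorphic_map n D \<Omega> F \<longleftrightarrow>
     bij_betw F D \<Omega> \<and> Cn_holomorphic_map n D F \<and> Cn_holomorphic_map n \<Omega> (the_inv_into D F)"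

definition jacobian_det :: "nat \<Rightarrow> (cpoint \<Rightarrow> cpoint) \<Rightarrow> cpoint \<Rightarrow> complex" where
  "jacobian_det n F z =
     Determinant.det (Matrix.mat n n (\<lambda>(i, j). deriv (\<lambda>\<zeta>. F (z(j := \<zeta>)) i) (z j)))"

end

theory Submission imports Defs begin

text \<open>Let \<open>\<Omega> = {(a, b). |a| < 1, |b| < |1 + a|}\<close>, the image of the bidisc under the polynomial map
\<open>\<Phi> (z, w) = (z, (1 + z) w)\<close> with Jacobian determinant \<open>1 + z\<close>.  Transporting the Bergman kernel of
the bidisc gives the kernel of \<open>\<Omega>\<close> in closed form, and since polynomials stay polynomial after
composition with \<open>\<Phi>\<close> and multiplication by \<open>1 + z\<close>, the Bergman span at the origin contains all of them.

If \<open>F\<close> maps a circular domain onto \<open>\<Omega>\<close> with constant Jacobian, then conjugating the rotation by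
\<open>\<i>\<close> gives a self-map \<open>T\<close> of the bidisc with \<open>|det T'(z, w)| = |1 + z| / |1 + T\<^sub>1(z, w)|\<close>.  By the Schwarz-Pick
lemma the weight \<open>M (z, w) = |1 + z| (1 - |z|\<^sup>2) (1 - |w|\<^sup>2)\<close> satisfies \<open>M \<le> M \<circ> T\<close>.  Its only maximum is at
\<open>p = (1/3, 0)\<close>, so \<open>T\<close> fixes \<open>p\<close>; hence \<open>F\<close> maps the only fixed point \<open>0\<close> of the rotation to \<open>\<Phi> p\<close>, and
\<open>T'(p)\<close> is multiplication by \<open>\<i>\<close>.  But the second-order expansion of \<open>M\<close> at \<open>p\<close> differs in the
directions \<open>(1, 0)\<close> and \<open>(\<i>, 0)\<close>, a contradiction.\<close>

subsection \<open>Integration over discs\<close>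

text \<open>Conjugated with \<open>F\<close>, the rotation by \<open>\<i>\<close> is a self-map of
  \<open>\<Omega>\<close> with Jacobian \<open>c * (-1) / c = -1\<close>. This is where constancy of
  the Jacobian enters: the unknown map drops out of the estimate, and only the change of variables
  to the bidisc is left. A quarter turn is chosen because it exchanges the real and the imaginary
  direction, whereas a half turn leaves every quadratic form invariant. Up to higher order,
  \<open>M\<close> drops at \<open>p\<close> by \<open>2 * t\<^sup>2\<close> in the real direction
  and by \<open>t\<^sup>2\<close> in the imaginary one, so \<open>T\<close> would send
  \<open>(1/3 + \<i> * t, 0)\<close> to a point of smaller weight. The point \<open>1/3\<close>
  maximises \<open>(1 + r) * (1 - r\<^sup>2)\<close> on \<open>[0, 1]\<close>, with value
  \<open>32/27\<close>.

  On the kernel side, the Jacobian has no zero in the bidisc but tends to 0 at the boundary point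
  \<open>z = -1\<close>, so the kernel is unbounded on \<open>\<Omega>\<close> and its square
  integrability needs an argument: the growth \<open>1 / |1 + a|\<^sup>2\<close> is offset by slices
  of area \<open>pi * |1 + a|\<^sup>2\<close>. The reproducing formula comes from two uses of the
  one-variable disc formula, on a slice and then on the unit disc.\<close>

lemma borel_measurable_Complex_pair [measurable]:
  "(\<lambda>p. Complex (fst p) (snd p)) \<in> borel_measurable borel"
  unfolding Complex_eq by (intro borel_measurable_continuous_onI continuous_intros)

lemma lborel_complex_eq_distr: "lborel = distr lborel borel (\<lambda>p. Complex (fst p) (snd p))"
proof (rule lborel_eqI)
  fix l u :: complex
  assume *: "\<And>b. b \<in> Basis \<Longrightarrow> l \<bullet> b \<le> u \<bullet> b"
  have Re: "Re l \<le> Re u" and Im: "Im l \<le> Im u"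
    using *[of 1] *[of \<i>] by (auto simp: Basis_complex_def)
  have vim: "(\<lambda>p. Complex (fst p) (snd p)) -` box l u = box (Re l) (Re u) \<times> box (Im l) (Im u)"
    by (auto simp: box_def Basis_complex_def)
  have "emeasure (distr lborel borel (\<lambda>p. Complex (fst p) (snd p))) (box l u)
      = emeasure (lborel \<Otimes>\<^sub>M lborel) (box (Re l) (Re u) \<times> box (Im l) (Im u))"
    by (subst emeasure_distr) (auto simp: vim lborel_prod)
  also have "\<dots> = ennreal (Re u - Re l) * ennreal (Im u - Im l)"
    using Re Im by (subst lborel.emeasure_pair_measure_Times) auto
  also have "\<dots> = (\<Prod>b\<in>Basis. (u - l) \<bullet> b)"
    using Re Im by (simp add: Basis_complex_def ennreal_mult)
  finally show "emeasure (distr lborel borel (\<lambda>p. Complex (fst p) (snd p))) (box l u)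
      = (\<Prod>b\<in>Basis. (u - l) \<bullet> b)" .
qed simp

lemma nn_integral_lborel_complex:
  assumes [measurable]: "f \<in> borel_measurable borel"
  shows "(\<integral>\<^sup>+z. f z \<partial>lborel) = (\<integral>\<^sup>+x. \<integral>\<^sup>+y. f (Complex x y) \<partial>lborel \<partial>lborel)"
proof -
  have "(\<integral>\<^sup>+z. f z \<partial>lborel) = (\<integral>\<^sup>+p. f (Complex (fst p) (snd p)) \<partial>lborel)"
    by (subst lborel_complex_eq_distr, subst nn_integral_distr) auto
  also have "\<dots> = (\<integral>\<^sup>+x. \<integral>\<^sup>+y. f (Complex x y) \<partial>lborel \<partial>lborel)"
    unfolding lborel_prod[symmetric]
    by (subst lborel.nn_integral_fst[symmetric])
       (auto simp: lborel_prod intro: measurable_compose[OF _ assms])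
  finally show ?thesis .
qed

lemma nn_integral_lborel_complex':
  assumes [measurable]: "f \<in> borel_measurable borel"
  shows "(\<integral>\<^sup>+z. f z \<partial>lborel) = (\<integral>\<^sup>+y. \<integral>\<^sup>+x. f (Complex x y) \<partial>lborel \<partial>lborel)"
proof -
  show ?thesis
    unfolding nn_integral_lborel_complex[OF assms]
    by (rule lborel_pair.Fubini'[symmetric]) (auto simp: lborel_prod split_beta)
qed

text \<open>On each line of constant imaginary part the shear is a translation, so Fubini with the
  real part as inner variable reduces the claim to one dimension.\<close>

lemma nn_integral_shear_Re:
  fixes f :: "complex \<Rightarrow> ennreal"
  assumes [measurable]: "f \<in> borel_measurable borel"
  shows "(\<integral>\<^sup>+z. f (z + of_real (t * Im z)) \<partial>lborel) = (\<integral>\<^sup>+z. f z \<partial>lborel)"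
proof -
  have "(\<integral>\<^sup>+z. f (z + of_real (t * Im z)) \<partial>lborel)
      = (\<integral>\<^sup>+y. \<integral>\<^sup>+x. f (Complex (t * y + 1 * x) y) \<partial>lborel \<partial>lborel)"
    by (subst nn_integral_lborel_complex') (auto simp: Complex_eq algebra_simps)
  also have "\<dots> = (\<integral>\<^sup>+y. \<integral>\<^sup>+x. f (Complex x y) \<partial>lborel \<partial>lborel)"
  proof (rule nn_integral_cong)
    fix y :: real
    have "(\<lambda>x. f (Complex x y)) \<in> borel_measurable borel"
      unfolding Complex_eq by measurable
    from nn_integral_real_affine[OF this, of 1 "t * y"]
    show "(\<integral>\<^sup>+x. f (Complex (t * y + 1 * x) y) \<partial>lborel) = (\<integral>\<^sup>+x. f (Complex x y) \<partial>lborel)"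
      by simp
  qed
  also have "\<dots> = (\<integral>\<^sup>+z. f z \<partial>lborel)"
    by (rule nn_integral_lborel_complex'[symmetric]) simp
  finally show ?thesis .
qed

lemma nn_integral_shear_Im:
  fixes f :: "complex \<Rightarrow> ennreal"
  assumes [measurable]: "f \<in> borel_measurable borel"
  shows "(\<integral>\<^sup>+z. f (z + \<i> * of_real (t * Re z)) \<partial>lborel) = (\<integral>\<^sup>+z. f z \<partial>lborel)"
proof -
  have "(\<integral>\<^sup>+z. f (z + \<i> * of_real (t * Re z)) \<partial>lborel)
      = (\<integral>\<^sup>+x. \<integral>\<^sup>+y. f (Complex x (t * x + 1 * y)) \<partial>lborel \<partial>lborel)"
    by (subst nn_integral_lborel_complex) (auto simp: Complex_eq algebra_simps)
  also have "\<dots> = (\<integral>\<^sup>+x. \<integral>\<^sup>+y. f (Complex x y) \<partial>lborel \<partial>lborel)"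
  proof (rule nn_integral_cong)
    fix x :: real
    have "(\<lambda>y. f (Complex x y)) \<in> borel_measurable borel"
      unfolding Complex_eq by measurable
    from nn_integral_real_affine[OF this, of 1 "t * x"]
    show "(\<integral>\<^sup>+y. f (Complex x (t * x + 1 * y)) \<partial>lborel) = (\<integral>\<^sup>+y. f (Complex x y) \<partial>lborel)"
      by simp
  qed
  also have "\<dots> = (\<integral>\<^sup>+z. f z \<partial>lborel)"
    by (rule nn_integral_lborel_complex[symmetric]) simp
  finally show ?thesis .
qed

text \<open>A rotation other than \<open>\<plusminus>1\<close> is a product of three shears.\<close>

lemma nn_integral_rotation:
  fixes f :: "complex \<Rightarrow> ennreal"
  assumes f: "f \<in> borel_measurable borel" and c: "cmod c = 1"
  shows "(\<integral>\<^sup>+z. f (c * z) \<partial>lborel) = (\<integral>\<^sup>+z. f z \<partial>lborel)"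
proof -
  have gen: "(\<integral>\<^sup>+z. f (c * z) \<partial>lborel) = (\<integral>\<^sup>+z. f z \<partial>lborel)"
    if c: "cmod c = 1" and q: "Im c \<noteq> 0" and f [measurable]: "f \<in> borel_measurable borel"
    for c and f :: "complex \<Rightarrow> ennreal"
  proof -
    \<comment> \<open>For \<open>c = cis \<theta>\<close> this is
      \<open>- tan (\<theta> / 2)\<close>, the parameter of both outer shears; the middle one has
      parameter \<open>sin \<theta>\<close>. The facts \<open>tq\<close> and \<open>tp\<close> are
      the half-angle relations that turn the product of the shears into \<open>c\<close>.\<close>
    define t where "t = (Re c - 1) / Im c"
    have tq: "t * Im c = Re c - 1"
      using q by (simp add: t_def)
    have "(Re c)\<^sup>2 + (Im c)\<^sup>2 = 1"
      using c by (simp add: cmod_power2[symmetric])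
    note unit = this
    have "t * (Re c + 1) * Im c = (t * Im c) * (Re c + 1)"
      by simp
    also have "\<dots> = (Re c)\<^sup>2 - 1"
      unfolding tq by (simp add: power2_eq_square algebra_simps)
    also have "\<dots> = - Im c * Im c"
      using unit by (simp add: power2_eq_square)
    finally have "t * (Re c + 1) * Im c = - Im c * Im c" .
    then have "(t * (Re c + 1) + Im c) * Im c = 0"
      by (simp add: algebra_simps)
    then have tp: "t * (Re c + 1) = - Im c"
      using q by (simp add: eq_neg_iff_add_eq_0)
    define S where "S z = z + of_real (t * Im z)" for z
    define S' where "S' z = z + \<i> * of_real (Im c * Re z)" for z
    have [measurable]: "S \<in> borel_measurable borel" "S' \<in> borel_measurable borel"
      unfolding S_def S'_def by measurable
    have eq: "S (S' (S z)) = c * z" for z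
    proof (rule complex_eqI)
      have "Re (S (S' (S z))) = (1 + t * Im c) * Re z + (t * (1 + t * Im c) + t) * Im z"
        by (simp add: S_def S'_def algebra_simps)
      also have "\<dots> = Re (c * z)"
        using tq tp by (simp add: algebra_simps)
      finally show "Re (S (S' (S z))) = Re (c * z)" .
      have "Im (S (S' (S z))) = Im c * Re z + (t * Im c + 1) * Im z"
        by (simp add: S_def S'_def algebra_simps)
      also have "\<dots> = Im (c * z)"
        using tq by (simp add: algebra_simps)
      finally show "Im (S (S' (S z))) = Im (c * z)" .
    qed
    have "(\<integral>\<^sup>+z. f (c * z) \<partial>lborel) = (\<integral>\<^sup>+z. f (S (S' (S z))) \<partial>lborel)"
      by (simp add: eq)
    also have "\<dots> = (\<integral>\<^sup>+z. f (S (S' z)) \<partial>lborel)"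
      using nn_integral_shear_Re[of "\<lambda>z. f (S (S' z))" t] by (simp add: S_def[of "_::complex"])
    also have "\<dots> = (\<integral>\<^sup>+z. f (S z) \<partial>lborel)"
      using nn_integral_shear_Im[of "\<lambda>z. f (S z)" "Im c"] by (simp add: S'_def)
    also have "\<dots> = (\<integral>\<^sup>+z. f z \<partial>lborel)"
      using nn_integral_shear_Re[of f t] by (simp add: S_def)
    finally show ?thesis .
  qed
  show ?thesis
  proof (cases "Im c = 0")
    case False
    with gen c f show ?thesis by blast
  next
    case True
    with c have "\<bar>Re c\<bar> = 1"
      by (simp add: cmod_def)
    with True have "c = 1 \<or> c = -1"
      by (auto simp: complex_eq_iff)
    \<comment> \<open>\<open>-1 = \<i> * \<i>\<close>, and \<open>\<i>\<close> falls under the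
      generic case.\<close>
    moreover have "(\<integral>\<^sup>+z. f (-1 * z) \<partial>lborel) = (\<integral>\<^sup>+z. f z \<partial>lborel)"
    proof -
      have m: "(\<lambda>z. f (\<i> * z)) \<in> borel_measurable borel"
        using f by measurable
      show ?thesis
        using gen[OF _ _ m, of \<i>] gen[OF _ _ f, of \<i>] by (simp add: mult.assoc[symmetric])
    qed
    ultimately show ?thesis by auto
  qed
qed

lemma lborel_distr_rotation:
  assumes c: "cmod c = 1"
  shows "distr lborel borel ((*) c) = (lborel :: complex measure)"
proof (rule measure_eqI)
  fix A assume "A \<in> sets (distr lborel borel ((*) c))"
  then have [measurable]: "A \<in> sets borel" by simp
  have "emeasure (distr lborel borel ((*) c)) A = (\<integral>\<^sup>+z. indicator A z \<partial>distr lborel borel ((*) c))"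
    by simp
  also have "\<dots> = (\<integral>\<^sup>+z. indicator A (c * z) \<partial>lborel)"
    by (rule nn_integral_distr) auto
  also have "\<dots> = emeasure lborel A"
    by (subst nn_integral_rotation[OF _ c]) auto
  finally show "emeasure (distr lborel borel ((*) c)) A = emeasure lborel A" .
qed simp

lemma integral_rotation:
  fixes f :: "complex \<Rightarrow> 'b::{banach, second_countable_topology}"
  assumes [measurable]: "f \<in> borel_measurable borel" and c: "cmod c = 1"
  shows "(\<integral>z. f (c * z) \<partial>lborel) = (\<integral>z. f z \<partial>lborel)"
  by (subst (2) lborel_distr_rotation[OF c, symmetric], subst integral_distr) auto

lemma integrable_rotation:
  fixes f :: "complex \<Rightarrow> 'b::{banach, second_countable_topology}"
  assumes f: "integrable lborel f" and c: "cmod c = 1"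
  shows "integrable lborel (\<lambda>z. f (c * z))"
proof -
  have "f \<in> borel_measurable borel"
    using f by auto
  then show ?thesis
    using f integrable_distr_eq[of "(*) c" lborel borel f] lborel_distr_rotation[OF c] by simp
qed

text \<open>The preimage of \<open>{..a}\<close> is a closed disc of area \<open>pi * a\<close> for
  nonnegative \<open>a\<close>, hence the constant density. This takes the place of polar
  coordinates.\<close>

lemma distr_lborel_cmod_power2:
  "distr lborel borel (\<lambda>w::complex. (cmod w)\<^sup>2) = density lborel (\<lambda>s. ennreal pi * indicator {0..} s)"
proof (rule measure_eqI_generator_eq)
  let ?E = "range (atMost :: real \<Rightarrow> real set)"
  show "Int_stable ?E"
    by (auto simp: Int_stable_def)
  show "sets (distr lborel borel (\<lambda>w::complex. (cmod w)\<^sup>2)) = sigma_sets UNIV ?E"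
    by (simp add: borel_eq_atMost)
  show "sets (density lborel (\<lambda>s. ennreal pi * indicator {0..} s)) = sigma_sets UNIV ?E"
    by (simp add: borel_eq_atMost)
  have em1: "emeasure (distr lborel borel (\<lambda>w::complex. (cmod w)\<^sup>2)) {..a} = ennreal (pi * max 0 a)" for a
  proof (cases "a \<ge> 0")
    case True
    have "(\<lambda>w::complex. (cmod w)\<^sup>2) -` {..a} = cball 0 (sqrt a)"
      using True by (auto simp: real_le_rsqrt sqrt_ge_absD)
    then show ?thesis
      using True by (subst emeasure_distr) (auto simp: emeasure_cball eval_unit_ball_vol max_def)
  next
    case False
    then have "(\<lambda>w::complex. (cmod w)\<^sup>2) -` {..a} = {}"
      by (auto simp: not_le dest: order_trans[OF zero_le_power2])
    then show ?thesis
      using False by (subst emeasure_distr) auto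
  qed
  have em2: "emeasure (density lborel (\<lambda>s. ennreal pi * indicator {0..} s)) {..a} = ennreal (pi * max 0 a)" for a
  proof -
    have "emeasure (density lborel (\<lambda>s. ennreal pi * indicator {0..} s)) {..a}
        = (\<integral>\<^sup>+s. ennreal pi * indicator {0..a} s \<partial>lborel)"
      by (subst emeasure_density) (auto intro!: nn_integral_cong split: split_indicator)
    also have "\<dots> = ennreal (pi * max 0 a)"
      by (subst nn_integral_cmult) (auto simp: ennreal_mult max_def)
    finally show ?thesis .
  qed
  show "emeasure (distr lborel borel (\<lambda>w::complex. (cmod w)\<^sup>2)) X
      = emeasure (density lborel (\<lambda>s. ennreal pi * indicator {0..} s)) X" if "X \<in> ?E" for X
    using that em1 em2 by auto
  show "range (\<lambda>n::nat. {..real n}) \<subseteq> ?E" by auto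
  show "(\<Union>n::nat. {..real n}) = UNIV"
    by (auto simp: real_arch_simple)
  show "emeasure (distr lborel borel (\<lambda>w::complex. (cmod w)\<^sup>2)) {..real i} \<noteq> \<infinity>" for i
    by (simp add: em1)
qed auto

lemma integral_radial_ball:
  fixes \<psi> :: "real \<Rightarrow> complex"
  assumes \<psi>: "continuous_on {0..R\<^sup>2} \<psi>" and R: "R > 0"
  shows "(LINT w:ball 0 R|lborel. \<psi> ((cmod w)\<^sup>2)) = of_real pi * (\<integral>s. indicator {0..R\<^sup>2} s *\<^sub>R \<psi> s \<partial>lborel)"
proof -
  \<comment> \<open>Half-open because the ball is open. The endpoint is a null set and is restored
    at the end, where a compact interval is wanted for the fundamental theorem of calculus.\<close>
  define g where "g s = indicator {0..<R\<^sup>2} s *\<^sub>R \<psi> s" for s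
  have "continuous_on {0..<R\<^sup>2} \<psi>"
    by (rule continuous_on_subset[OF \<psi>]) auto
  then have [measurable]: "g \<in> borel_measurable borel"
    unfolding g_def by (intro borel_measurable_continuous_on_indicator) auto
  have "(LINT w:ball 0 R|lborel. \<psi> ((cmod w)\<^sup>2)) = (\<integral>w. g ((cmod w)\<^sup>2) \<partial>lborel)"
    unfolding set_lebesgue_integral_def
    using R by (intro Bochner_Integration.integral_cong)
      (auto simp: g_def indicator_def power_strict_mono intro: power2_less_imp_less)
  also have "\<dots> = (\<integral>s. g s \<partial>distr lborel borel (\<lambda>w::complex. (cmod w)\<^sup>2))"
    by (subst integral_distr) auto
  also have "\<dots> = (\<integral>s. pi *\<^sub>R g s \<partial>lborel)"
  proof -
    have "density lborel (\<lambda>s. ennreal pi * indicator {0..} s)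
        = density lborel (\<lambda>s::real. ennreal (pi * indicator {0..} s))"
      by (intro arg_cong2[where f = density]) (auto simp: fun_eq_iff indicator_def)
    moreover have "(\<integral>s. g s \<partial>density lborel (\<lambda>s::real. ennreal (pi * indicator {0..} s)))
        = (\<integral>s. (pi * indicator {0..} s) *\<^sub>R g s \<partial>lborel)"
      by (rule integral_density) auto
    ultimately show ?thesis
      unfolding distr_lborel_cmod_power2
      by (auto simp: g_def indicator_def intro!: Bochner_Integration.integral_cong)
  qed
  also have "\<dots> = of_real pi * (\<integral>s. g s \<partial>lborel)"
    by (simp add: scaleR_conv_of_real)
  also have "(\<integral>s. g s \<partial>lborel) = (\<integral>s. indicator {0..R\<^sup>2} s *\<^sub>R \<psi> s \<partial>lborel)"
  proof (rule integral_cong_AE)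
    have "continuous_on {0..R\<^sup>2} \<psi>" by (fact \<psi>)
    then show "(\<lambda>s. indicator {0..R\<^sup>2} s *\<^sub>R \<psi> s) \<in> borel_measurable lborel"
      using borel_measurable_continuous_on_indicator[of "{0..R\<^sup>2}" \<psi>] by simp
    show "AE s in lborel. g s = indicator {0..R\<^sup>2} s *\<^sub>R \<psi> s"
      using AE_lborel_singleton[of "R\<^sup>2"]
      by eventually_elim (auto simp: g_def indicator_def)
  qed auto
  finally show ?thesis .
qed

subsection \<open>The reproducing formula on a disc\<close>

text \<open>On the circle of radius \<open>r\<close> one has \<open>cnj u = r\<^sup>2 / u\<close>,
  so the antiholomorphic factor becomes \<open>(u - v) / u\<close> with
  \<open>v = z * r\<^sup>2 / R\<^sup>2\<close>. With \<open>dt = du / (\<i> * u)\<close> the average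
  is the Cauchy integral for the derivative of \<open>u * g u\<close> at \<open>v\<close>.\<close>

lemma circle_average:
  assumes g: "g holomorphic_on ball 0 R" and r: "0 < r" "r < R" and z: "z \<in> ball 0 R"
    and D: "((\<lambda>u. u * g u) has_field_derivative D) (at (z * of_real (r\<^sup>2 / R\<^sup>2)))"
  shows "((\<lambda>t. g (of_real r * cis t) / (1 - z * cnj (of_real r * cis t) / of_real (R\<^sup>2))\<^sup>2)
           has_integral of_real (2 * pi) * D) {0..2 * pi}"
proof -
  have R: "R > 0" using r by simp
  define v where "v = z * of_real (r\<^sup>2 / R\<^sup>2)"
  have "cmod v = cmod z / R * (r / R) * r"
    using r by (simp add: v_def norm_mult norm_divide norm_power power2_eq_square)
  also have "\<dots> < 1 * 1 * r"
    using z r R by (intro mult_strict_right_mono mult_strict_mono) auto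
  finally have v: "v \<in> ball 0 r" by simp
  let ?f = "\<lambda>u. u * g u"
  have hol: "?f holomorphic_on ball 0 R"
    by (intro holomorphic_intros g)
  have cont: "continuous_on (cball 0 r) ?f"
    using r by (intro holomorphic_on_imp_continuous_on holomorphic_on_subset[OF hol]) auto
  have hol': "?f holomorphic_on ball 0 r"
    using r by (intro holomorphic_on_subset[OF hol]) auto
  let ?I = "contour_integral (circlepath 0 r) (\<lambda>u. ?f u / (u - v)\<^sup>2)"
  have 1: "(\<lambda>u. ?f u / (u - v)\<^sup>2) contour_integrable_on circlepath 0 r"
    and 2: "(?f has_field_derivative 1 / (2 * of_real pi * \<i>) * ?I) (at v)"
    by (rule Cauchy_derivative_integral_circlepath[OF cont hol' v])+
  have I: "?I = 2 * of_real pi * \<i> * D"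
    using DERIV_unique[OF 2 D[folded v_def]] by (auto simp: field_simps)
  have I': "- \<i> * (2 * of_real pi * \<i> * D) = of_real (2 * pi) * D"
    by (simp add: mult.left_commute[of \<i>] flip: mult.assoc)
  have "((\<lambda>u. ?f u / (u - v)\<^sup>2) has_contour_integral ?I) (part_circlepath 0 r 0 (2 * pi))"
    using has_contour_integral_integral[OF 1] by (simp add: circlepath_def)
  then have "((\<lambda>t. ?f (of_real r * cis t) / (of_real r * cis t - v)\<^sup>2 * of_real r * \<i> * cis t)
      has_integral ?I) {0..2 * pi}"
    by (subst (asm) has_contour_integral_part_circlepath_iff) auto
  from has_integral_mult_right[OF this, of "- \<i>"]
  have "((\<lambda>t. - \<i> * (?f (of_real r * cis t) / (of_real r * cis t - v)\<^sup>2 * of_real r * \<i> * cis t))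
      has_integral of_real (2 * pi) * D) {0..2 * pi}"
    unfolding I by (simp only: I')
  moreover have "- \<i> * (a * b * \<i> * c) = a * b * c" for a b c
  proof -
    have "- \<i> * (a * b * \<i> * c) = (- \<i> * \<i>) * (a * b * c)"
      by (simp only: mult_ac)
    then show ?thesis by simp
  qed
  ultimately have "((\<lambda>t. ?f (of_real r * cis t) / (of_real r * cis t - v)\<^sup>2 * of_real r * cis t)
      has_integral of_real (2 * pi) * D) {0..2 * pi}"
    by (simp only:)
  moreover have "?f (of_real r * cis t) / (of_real r * cis t - v)\<^sup>2 * of_real r * cis t
      = g (of_real r * cis t) / (1 - z * cnj (of_real r * cis t) / of_real (R\<^sup>2))\<^sup>2" for t
  proof -
    define u where "u = of_real r * cis t"
    have u: "u \<noteq> 0" using r by (simp add: u_def)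
    have uu: "u * cnj u = of_real (r\<^sup>2)"
      using r by (simp add: u_def power2_eq_square cis_cnj cis_mult)
    have "u - v = u * (1 - z * cnj u / of_real (R\<^sup>2))"
      using R by (simp add: v_def field_simps uu[symmetric] del: of_real_power)
    then have "(u - v)\<^sup>2 = u\<^sup>2 * (1 - z * cnj u / of_real (R\<^sup>2))\<^sup>2"
      by (simp only: power_mult_distrib)
    then have "u * g u / (u - v)\<^sup>2 * u = g u / (1 - z * cnj u / of_real (R\<^sup>2))\<^sup>2"
      using u by (simp add: power2_eq_square[of u])
    then show ?thesis
      by (simp add: u_def mult.assoc)
  qed
  ultimately show ?thesis by simp
qed

text \<open>The start point \<open>w\<close> of the circle is rotated to the positive real axis:
  \<open>g\<close> becomes \<open>g (c * u)\<close> and \<open>z\<close> becomes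
  \<open>cnj c * z\<close>. The value \<open>D\<close> survives because
  \<open>c * cnj c = 1\<close>, and the factor \<open>c\<close> from the chain rule is divided out
  again.\<close>

lemma circle_average':
  assumes g: "g holomorphic_on ball 0 R" and w: "cmod w < R" "w \<noteq> 0" and z: "z \<in> ball 0 R"
    and D: "((\<lambda>u. u * g u) has_field_derivative D) (at (z * of_real ((cmod w)\<^sup>2 / R\<^sup>2)))"
  shows "((\<lambda>t. g (cis t * w) / (1 - z * cnj (cis t * w) / of_real (R\<^sup>2))\<^sup>2)
           has_integral of_real (2 * pi) * D) {0..2 * pi}"
proof -
  define r where "r = cmod w"
  have r: "0 < r" "r < R" using w by (auto simp: r_def)
  define c where "c = w / of_real r"
  have c: "cmod c = 1" "c \<noteq> 0" and wc: "w = c * of_real r"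
    using w by (auto simp: c_def r_def norm_divide)
  have cc: "c * cnj c = 1"
    using c by (simp add: complex_norm_square[symmetric])
  let ?g = "\<lambda>u. g (c * u)" and ?z = "cnj c * z"
  have "?g holomorphic_on ball 0 R"
    by (rule holomorphic_on_compose_gen[OF _ g, of "\<lambda>u. c * u", unfolded o_def])
       (auto intro!: holomorphic_intros simp: norm_mult c)
  moreover have "?z \<in> ball 0 R"
    using z c by (simp add: norm_mult)
  moreover have "((\<lambda>u. u * ?g u) has_field_derivative D) (at (?z * of_real (r\<^sup>2 / R\<^sup>2)))"
  proof -
    have eq: "c * (?z * of_real (r\<^sup>2 / R\<^sup>2)) = z * of_real (r\<^sup>2 / R\<^sup>2)"
      using cc by (metis mult.assoc mult.left_neutral)
    have "((\<lambda>u. (c * u) * g (c * u)) has_field_derivative D * c) (at (?z * of_real (r\<^sup>2 / R\<^sup>2)))"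
      by (rule DERIV_chain2[where f = "\<lambda>u. u * g u" and g = "\<lambda>u. c * u"], unfold eq)
         (use D in \<open>auto simp: r_def intro!: derivative_eq_intros\<close>)
    from DERIV_cdivide[OF this, of c] show ?thesis
      using c by simp
  qed
  ultimately have "((\<lambda>t. ?g (of_real r * cis t) / (1 - ?z * cnj (of_real r * cis t) / of_real (R\<^sup>2))\<^sup>2)
           has_integral of_real (2 * pi) * D) {0..2 * pi}"
    by (intro circle_average r)
  then show ?thesis
    by (simp add: wc mult_ac)
qed

text \<open>The integral is unchanged by rotating the integrand; averaging over all rotations turns the inner
  integrals into Cauchy integrals depending only on \<open>|w|\<^sup>2\<close>, which is uniformly distributed.\<close>

proposition disc_reproducing:
  assumes g: "g holomorphic_on ball 0 R" and z: "z \<in> ball 0 R"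
    and int: "set_integrable lborel (ball 0 R) g"
  shows "(LINT w:ball 0 R|lborel. g w / (1 - z * cnj w / of_real (R\<^sup>2))\<^sup>2) = of_real (pi * R\<^sup>2) * g z"
proof -
  have zR: "cmod z < R" using z by simp
  then have R: "R > 0" using norm_ge_zero[of z] by linarith
  define k where "k w = 1 / (1 - z * cnj w / of_real (R\<^sup>2))\<^sup>2" for w
  define X where "X w = indicator (ball 0 R) w *\<^sub>R (g w * k w)" for w
  \<comment> \<open>The derivative of \<open>u * g u\<close>, which is what the circle averages
    produce.\<close>
  define h where "h u = g u + u * deriv g u" for u
  have lt: "cmod (z * cnj w / of_real (R\<^sup>2)) \<le> cmod z / R" if "w \<in> ball 0 R" for w
  proof -
    have "cmod (z * cnj w / of_real (R\<^sup>2)) = cmod z * cmod w / R\<^sup>2"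
      by (simp add: norm_mult norm_divide norm_power)
    also have "\<dots> \<le> cmod z * R / R\<^sup>2"
      using that R by (intro divide_right_mono mult_left_mono) auto
    finally show ?thesis using R by (simp add: power2_eq_square)
  qed
  have q: "cmod z / R < 1" using zR R by simp
  have lower: "1 - cmod z / R \<le> cmod (1 - z * cnj w / of_real (R\<^sup>2))" if "w \<in> ball 0 R" for w
    using norm_triangle_ineq2[of 1 "z * cnj w / of_real (R\<^sup>2)"] lt[OF that] by simp
  have k_bound: "cmod (k w) \<le> 1 / (1 - cmod z / R)\<^sup>2" if "w \<in> ball 0 R" for w
    unfolding k_def norm_divide norm_power norm_one
    using lower[OF that] q by (intro divide_left_mono power_mono mult_pos_pos zero_less_power) auto
  have [measurable]: "(\<lambda>w. indicator (ball 0 R) w *\<^sub>R g w) \<in> borel_measurable borel"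
    using int by (auto simp: set_integrable_def dest: borel_measurable_integrable)
  have [measurable]: "cnj \<in> borel_measurable borel"
    by (intro borel_measurable_continuous_onI continuous_intros)
  have [measurable]: "k \<in> borel_measurable borel"
    unfolding k_def by measurable
  have X_eq: "X w = (indicator (ball 0 R) w *\<^sub>R g w) * k w" for w
    by (simp add: X_def)
  have [measurable]: "X \<in> borel_measurable borel"
    unfolding X_eq by measurable
  \<comment> \<open>With \<open>z\<close> fixed inside the disc the kernel is bounded by
    \<open>1 / (1 - cmod z / R)\<^sup>2\<close>, so integrability of \<open>g\<close> is
    enough.\<close>
  have Xint: "integrable lborel X"
  proof (rule Bochner_Integration.integrable_bound)
    show "integrable lborel (\<lambda>w. (1 / (1 - cmod z / R)\<^sup>2) *\<^sub>R (indicator (ball 0 R) w *\<^sub>R g w))"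
      using int by (intro integrable_scaleR_right) (auto simp: set_integrable_def)
    have "cmod (X w) \<le> cmod ((1 / (1 - cmod z / R)\<^sup>2) *\<^sub>R (indicator (ball 0 R) w *\<^sub>R g w))" for w
    proof (cases "w \<in> ball 0 R")
      case True
      then show ?thesis
        using mult_left_mono[OF k_bound[OF True], of "cmod (g w)"] by (simp add: X_def norm_mult norm_divide norm_power)
    qed (simp add: X_def)
    then show "AE w in lborel. cmod (X w) \<le> cmod ((1 / (1 - cmod z / R)\<^sup>2) *\<^sub>R (indicator (ball 0 R) w *\<^sub>R g w))"
      by simp
  qed simp
  define Y where "Y t w = indicator {0..2*pi} t *\<^sub>R X (cis t * w)" for t :: real and w
  have [measurable]: "cis \<in> borel_measurable borel"
    by (intro borel_measurable_continuous_onI continuous_intros)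
  have Ymeas: "case_prod Y \<in> borel_measurable (lborel \<Otimes>\<^sub>M lborel)"
    unfolding Y_def by measurable
  have intXt: "integrable lborel (\<lambda>w. X (cis t * w))" for t
    by (rule integrable_rotation[OF Xint]) simp
  have Yint: "integrable (lborel \<Otimes>\<^sub>M lborel) (case_prod Y)"
  proof (rule lborel_pair.Fubini_integrable[OF Ymeas])
    have "(\<integral>w. norm (case_prod Y (t, w)) \<partial>lborel) = indicator {0..2*pi} t * (\<integral>w. norm (X w) \<partial>lborel)" for t
      using integral_rotation[of "\<lambda>w. norm (X w)" "cis t"] by (simp add: Y_def)
    moreover have "integrable lborel (\<lambda>t::real. indicator {0..2*pi} t * (\<integral>w. norm (X w) \<partial>lborel))"
      by (intro integrable_mult_left) (simp add: integrable_real_indicator)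
    ultimately show "integrable lborel (\<lambda>t. \<integral>w. norm (case_prod Y (t, w)) \<partial>lborel)"
      by simp
    show "AE t in lborel. integrable lborel (\<lambda>w. case_prod Y (t, w))"
      using intXt by (simp add: Y_def)
  qed
  define I where "I = (\<integral>w. X w \<partial>lborel)"
  have "(\<integral>t. (\<integral>w. Y t w \<partial>lborel) \<partial>lborel) = (\<integral>t. indicator {0..2*pi} t *\<^sub>R I \<partial>lborel)"
    using integral_rotation[of X "cis _"] by (simp add: Y_def I_def)
  also have "\<dots> = of_real (2 * pi) * I"
    by (simp add: scaleR_conv_of_real)
  finally have 1: "(\<integral>t. (\<integral>w. Y t w \<partial>lborel) \<partial>lborel) = of_real (2 * pi) * I" .

  have dg: "(g has_field_derivative deriv g u) (at u)" if "u \<in> ball 0 R" for u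
    using g that by (intro holomorphic_derivI) auto
  have dh: "((\<lambda>u. u * g u) has_field_derivative h u) (at u)" if "u \<in> ball 0 R" for u
    using dg[OF that] by (auto simp: h_def intro!: derivative_eq_intros)
  have zs: "z * of_real (s / R\<^sup>2) \<in> ball 0 R" if "s \<in> {0..R\<^sup>2}" for s
  proof -
    have "cmod (z * of_real (s / R\<^sup>2)) = cmod z * (s / R\<^sup>2)"
      using that by (simp add: norm_mult norm_divide norm_power)
    also have "\<dots> \<le> cmod z * 1"
      using that R by (intro mult_left_mono) auto
    finally show ?thesis using zR by simp
  qed
  \<comment> \<open>At \<open>w = 0\<close> the circle degenerates; this single point is a null set
    for the outer integral.\<close>
  have inner: "(\<integral>t. Y t w \<partial>lborel) = indicator (ball 0 R) w *\<^sub>R (of_real (2 * pi) * h (z * of_real ((cmod w)\<^sup>2 / R\<^sup>2)))"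
    if "w \<noteq> 0" for w
  proof (cases "w \<in> ball 0 R")
    case True
    have s: "(cmod w)\<^sup>2 \<in> {0..R\<^sup>2}"
      using True by (auto intro: power_mono)
    have hi: "((\<lambda>t. g (cis t * w) * k (cis t * w)) has_integral of_real (2 * pi) * h (z * of_real ((cmod w)\<^sup>2 / R\<^sup>2))) {0..2*pi}"
      using circle_average'[OF g _ that z dh[OF zs[OF s]]] True by (simp add: k_def)
    have "continuous_on {0..2*pi} (\<lambda>t. g (cis t * w) * k (cis t * w))"
    proof -
      have nz: "1 - z * cnj (cis t * w) / of_real (R\<^sup>2) \<noteq> 0" for t
        using lower[of "cis t * w"] q True by (auto simp: norm_mult)
      have "continuous_on {0..2*pi} (\<lambda>t. g (cis t * w))"
        by (rule continuous_on_compose2[OF holomorphic_on_imp_continuous_on[OF g]])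
           (use True in \<open>auto intro!: continuous_intros simp: norm_mult\<close>)
      then show ?thesis
        unfolding k_def using nz R by (intro continuous_intros) auto
    qed
    then have "(\<integral>t. indicator {0..2*pi} t *\<^sub>R (g (cis t * w) * k (cis t * w)) \<partial>lborel)
        = integral {0..2*pi} (\<lambda>t. g (cis t * w) * k (cis t * w))"
      using set_borel_integral_eq_integral(2)[OF borel_integrable_compact[of "{0..2*pi}", folded set_integrable_def]]
      by (simp add: set_lebesgue_integral_def)
    also have "\<dots> = of_real (2 * pi) * h (z * of_real ((cmod w)\<^sup>2 / R\<^sup>2))"
      using hi by (rule integral_unique)
    finally show ?thesis
      using True by (simp add: Y_def X_def norm_mult)
  next
    case False
    then show ?thesis by (simp add: Y_def X_def norm_mult)
  qed
  have contD: "continuous_on {0..R\<^sup>2} (\<lambda>s. h (z * of_real (s / R\<^sup>2)))"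
  proof -
    have "h holomorphic_on ball 0 R"
      unfolding h_def by (intro holomorphic_intros holomorphic_deriv g) auto
    then show ?thesis
      by (rule continuous_on_compose2[OF holomorphic_on_imp_continuous_on])
         (use R zs in \<open>auto intro!: continuous_intros\<close>)
  qed
  have 2: "(\<integral>w. (\<integral>t. Y t w \<partial>lborel) \<partial>lborel) = of_real (2 * pi) * (LINT w:ball 0 R|lborel. h (z * of_real ((cmod w)\<^sup>2 / R\<^sup>2)))"
  proof -
    have "(\<integral>w. (\<integral>t. Y t w \<partial>lborel) \<partial>lborel)
       = (\<integral>w. of_real (2 * pi) * (indicator (ball 0 R) w *\<^sub>R h (z * of_real ((cmod w)\<^sup>2 / R\<^sup>2))) \<partial>lborel)"
    proof (rule integral_cong_AE)
      show "(\<lambda>w. \<integral>t. Y t w \<partial>lborel) \<in> borel_measurable lborel"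
        using Ymeas by measurable
      have "continuous_on (ball 0 R) (\<lambda>w. h (z * of_real ((cmod w)\<^sup>2 / R\<^sup>2)))"
        by (rule continuous_on_compose2[OF contD])
           (auto intro!: continuous_intros power_mono)
      then have "(\<lambda>w. indicator (ball 0 R) w *\<^sub>R h (z * of_real ((cmod w)\<^sup>2 / R\<^sup>2))) \<in> borel_measurable lborel"
        using borel_measurable_continuous_on_indicator[of "ball 0 R" "\<lambda>w. h (z * of_real ((cmod w)\<^sup>2 / R\<^sup>2))"]
        by simp
      then show "(\<lambda>w. of_real (2 * pi) * (indicator (ball 0 R) w *\<^sub>R h (z * of_real ((cmod w)\<^sup>2 / R\<^sup>2)))) \<in> borel_measurable lborel"
        by (rule borel_measurable_times[OF borel_measurable_const])
      show "AE w in lborel. (\<integral>t. Y t w \<partial>lborel) = of_real (2 * pi) * (indicator (ball 0 R) w *\<^sub>R h (z * of_real ((cmod w)\<^sup>2 / R\<^sup>2)))"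
        using AE_lborel_singleton[of 0] by eventually_elim (simp add: inner)
    qed
    then show ?thesis
      by (simp only: set_lebesgue_integral_def integral_mult_right_zero)
  qed
  \<comment> \<open>The integrand over \<open>s\<close> is the exact derivative of
    \<open>s * g (z * s / R\<^sup>2)\<close>: evaluation at \<open>s = R\<^sup>2\<close> gives
    \<open>R\<^sup>2 * g z\<close>, and the lower end contributes 0.\<close>
  have 3: "(LINT w:ball 0 R|lborel. h (z * of_real ((cmod w)\<^sup>2 / R\<^sup>2))) = of_real pi * (of_real (R\<^sup>2) * g z)"
  proof -
    have "(\<integral>s. indicator {0..R\<^sup>2} s *\<^sub>R h (z * of_real (s / R\<^sup>2)) \<partial>lborel)
        = of_real (R\<^sup>2) * g (z * of_real (R\<^sup>2 / R\<^sup>2)) - of_real 0 * g (z * of_real (0 / R\<^sup>2))"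
    proof (rule integral_FTC_atLeastAtMost[where F = "\<lambda>s. of_real s * g (z * of_real (s / R\<^sup>2))"])
      fix s :: real assume s: "0 \<le> s" "s \<le> R\<^sup>2"
      have "((\<lambda>x. z * of_real (x / R\<^sup>2)) has_vector_derivative z * of_real (1 / R\<^sup>2)) (at s within {0..R\<^sup>2})"
        by (auto intro!: derivative_eq_intros)
      from field_vector_diff_chain_within[OF this has_field_derivative_at_within[OF dg[OF zs]]] s
      have "((\<lambda>x. g (z * of_real (x / R\<^sup>2))) has_vector_derivative z * of_real (1 / R\<^sup>2) * deriv g (z * of_real (s / R\<^sup>2))) (at s within {0..R\<^sup>2})"
        by (simp add: o_def)
      then show "((\<lambda>s. of_real s * g (z * of_real (s / R\<^sup>2))) has_vector_derivative h (z * of_real (s / R\<^sup>2))) (at s within {0..R\<^sup>2})"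
        by (auto intro!: derivative_eq_intros simp: h_def)
    qed (use contD in auto)
    then show ?thesis
      using integral_radial_ball[OF contD R] R by simp
  qed
  have "of_real (2 * pi) * I = of_real (2 * pi) * (of_real pi * (of_real (R\<^sup>2) * g z))"
    using 1 2 3 lborel_pair.Fubini_integral[OF Yint] by simp
  then have "I = of_real (pi * R\<^sup>2) * g z" by simp
  then show ?thesis
    by (simp add: I_def X_def k_def set_lebesgue_integral_def)
qed

subsection \<open>Points of \<open>C\<^sup>2\<close> as pairs\<close>

text \<open>The analysis takes place on pairs, where norm, derivative and Lebesgue measure are
  available as type class structure. The restriction to \<open>{..<2}\<close> makes the values
  extensional, so that \<open>of_pair\<close> is a bijection onto the points of
  \<open>Cn_top 2\<close>.\<close>

definition of_pair :: "complex \<times> complex \<Rightarrow> cpoint" where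
  "of_pair p = (\<lambda>i\<in>{..<2}. if i = 0 then fst p else snd p)"

definition to_pair :: "cpoint \<Rightarrow> complex \<times> complex" where
  "to_pair w = (w 0, w 1)"

lemma topspace_Cn_top: "topspace (Cn_top n) = {..<n} \<rightarrow>\<^sub>E UNIV"
  by (simp add: Cn_top_def)

lemma of_pair_0 [simp]: "of_pair p 0 = fst p" and of_pair_1 [simp]: "of_pair p (Suc 0) = snd p"
  by (simp_all add: of_pair_def)

lemma to_pair_of_pair [simp]: "to_pair (of_pair p) = p"
  by (simp add: to_pair_def)

lemma of_pair_in_topspace [simp]: "of_pair p \<in> topspace (Cn_top 2)"
  by (simp add: topspace_Cn_top of_pair_def)

lemma of_pair_to_pair [simp]:
  assumes "w \<in> topspace (Cn_top 2)" shows "of_pair (to_pair w) = w"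
proof
  fix i
  show "of_pair (to_pair w) i = w i"
    using assms by (cases "i < 2") (auto simp: of_pair_def to_pair_def topspace_Cn_top less_2_cases_iff PiE_def extensional_def)
qed

lemma inj_of_pair: "inj of_pair"
  by (metis injI to_pair_of_pair)

lemma of_pair_eq_iff [simp]: "of_pair p = of_pair q \<longleftrightarrow> p = q"
  using inj_of_pair by (simp add: inj_eq)

lemma of_pair_upd_0: "(of_pair p)(0 := x) = of_pair (x, snd p)"
  and of_pair_upd_1: "(of_pair p)(Suc 0 := x) = of_pair (fst p, x)"
  by (auto simp: of_pair_def fun_eq_iff less_2_cases_iff)

lemma continuous_map_of_pair: "continuous_map euclidean (Cn_top 2) of_pair"
  unfolding Cn_top_def continuous_map_componentwise
proof (intro conjI ballI)
  show "of_pair ` topspace euclidean \<subseteq> extensional {..<2}"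
    by (auto simp: of_pair_def)
  fix k :: nat assume "k \<in> {..<2}"
  then have "k = 0 \<or> k = 1" by auto
  then show "continuous_map euclidean euclidean (\<lambda>p. of_pair p k)"
    using continuous_on_fst[OF continuous_on_id] continuous_on_snd[OF continuous_on_id] by auto
qed

lemma continuous_map_to_pair: "continuous_map (Cn_top 2) euclidean to_pair"
proof -
  have "continuous_map (Cn_top 2) (prod_topology euclidean euclidean) to_pair"
    unfolding Cn_top_def to_pair_def
    by (intro continuous_map_paired[THEN iffD2] conjI continuous_map_product_projection) auto
  then show ?thesis by (simp add: euclidean_product_topology)
qed

lemma openin_Cn_top_image_of_pair:
  assumes "open S" shows "openin (Cn_top 2) (of_pair ` S)"
proof -
  have "of_pair ` S = {w \<in> topspace (Cn_top 2). to_pair w \<in> S}"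
    by (auto intro: rev_image_eqI)
  then show ?thesis
    using openin_continuous_map_preimage[OF continuous_map_to_pair] assms by simp
qed

lemma open_vimage_of_pair:
  assumes "openin (Cn_top 2) U" shows "open (of_pair -` U)"
  using openin_continuous_map_preimage[OF continuous_map_of_pair assms] by (simp add: vimage_def)

lemma eventually_atin_Cn_top:
  "eventually P (atin (Cn_top 2) (of_pair p)) \<longleftrightarrow> eventually (\<lambda>q. P (of_pair q)) (at p)"
proof
  assume "eventually P (atin (Cn_top 2) (of_pair p))"
  then obtain U where U: "openin (Cn_top 2) U" "of_pair p \<in> U" "\<forall>x\<in>U - {of_pair p}. P x"
    by (auto simp: eventually_atin)
  then show "eventually (\<lambda>q. P (of_pair q)) (at p)"
    unfolding eventually_at_topological using open_vimage_of_pair[OF U(1)]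
    by (intro exI[of _ "of_pair -` U"]) auto
next
  assume "eventually (\<lambda>q. P (of_pair q)) (at p)"
  then obtain S where S: "open S" "p \<in> S" "\<forall>q\<in>S. q \<noteq> p \<longrightarrow> P (of_pair q)"
    by (auto simp: eventually_at_topological)
  then show "eventually P (atin (Cn_top 2) (of_pair p))"
    unfolding eventually_atin using openin_Cn_top_image_of_pair[OF S(1)]
    by (intro disjI2 exI[of _ "of_pair ` S"]) auto
qed

lemma tendsto_atin_Cn_top:
  "(F \<longlongrightarrow> l) (atin (Cn_top 2) (of_pair p)) \<longleftrightarrow> ((\<lambda>q. F (of_pair q)) \<longlongrightarrow> l) (at p)"
  by (simp add: tendsto_def eventually_atin_Cn_top)

text \<open>The \<open>L2_set\<close> in the denominator is exactly the norm of the product type, so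
  the quotient is the usual Frechet remainder with a complex-linear derivative.\<close>

lemma Cn_differentiable_of_pair:
  "Cn_differentiable 2 f (of_pair p) \<longleftrightarrow>
     (\<exists>A B. ((\<lambda>q. f (of_pair q)) has_derivative (\<lambda>h. A * fst h + B * snd h)) (at p))"
proof -
  have bl: "bounded_linear (\<lambda>h. A * fst h + B * snd h)" for A B :: complex
    by (intro bounded_linear_intros)
  have *: "((\<lambda>w. (f w - f (of_pair p) - (\<Sum>i<2. L i * (w i - of_pair p i))) /
                of_real (L2_set (\<lambda>i. cmod (w i - of_pair p i)) {..<2})) \<longlongrightarrow> 0) (atin (Cn_top 2) (of_pair p))
      \<longleftrightarrow> ((\<lambda>q. f (of_pair q)) has_derivative (\<lambda>h. L 0 * fst h + L 1 * snd h)) (at p)" for L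
  proof -
    have norm: "L2_set (\<lambda>i. cmod (of_pair q i - of_pair p i)) {..<2} = norm (q - p)" for q
      by (simp add: L2_set_def numeral_2_eq_2 norm_prod_def)
    have sum: "(\<Sum>i<2. L i * (of_pair q i - of_pair p i)) = L 0 * fst (q - p) + L 1 * snd (q - p)" for q
      by (simp add: numeral_2_eq_2)
    show ?thesis
      unfolding tendsto_atin_Cn_top has_derivative_iff_norm norm sum
      using bl by (subst tendsto_norm_zero_iff[symmetric]) (simp add: norm_divide)
  qed
  show ?thesis
    unfolding Cn_differentiable_def *
  proof safe
    fix A B assume "((\<lambda>q. f (of_pair q)) has_derivative (\<lambda>h. A * fst h + B * snd h)) (at p)"
    then show "\<exists>L::nat \<Rightarrow> complex. ((\<lambda>q. f (of_pair q)) has_derivative (\<lambda>h. L 0 * fst h + L 1 * snd h)) (at p)"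
      by (intro exI[of _ "\<lambda>i. if i = 0 then A else B"]) simp
  qed blast
qed

lemma measurable_to_pair: "to_pair \<in> measurable (PiM {..<2} (\<lambda>_. lborel)) borel"
  unfolding to_pair_def borel_prod[symmetric] by measurable

lemma measurable_of_pair: "of_pair \<in> measurable lborel (PiM {..<2} (\<lambda>_. lborel))"
proof (rule measurable_PiM_single')
  fix i :: nat assume "i \<in> {..<2}"
  then have "i = 0 \<or> i = 1" by auto
  then show "(\<lambda>p. of_pair p i) \<in> measurable lborel lborel"
    using measurable_fst[of "borel :: complex measure" "borel :: complex measure"]
      measurable_snd[of "borel :: complex measure" "borel :: complex measure"] by (auto simp: borel_prod)
qed (simp add: of_pair_def PiE_def extensional_def)

lemma Cn_lborel_2_eq_distr: "Cn_lborel 2 = distr lborel (PiM {..<2} (\<lambda>_. lborel)) of_pair"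
proof -
  interpret product_sigma_finite "\<lambda>_::nat. lborel :: complex measure"
    by standard
  note [measurable] = measurable_of_pair
  have "distr lborel (PiM {..<2} (\<lambda>_. lborel)) of_pair = PiM {..<2} (\<lambda>_. lborel)"
  proof (rule PiM_eqI)
    fix A :: "nat \<Rightarrow> complex set" assume A: "\<And>i. i \<in> {..<2} \<Longrightarrow> A i \<in> sets lborel"
    have [measurable]: "A 0 \<in> sets borel" "A (Suc 0) \<in> sets borel"
      using A[of 0] A[of 1] by auto
    have vim: "of_pair -` (Pi\<^sub>E {..<2} A) = A 0 \<times> A 1"
    proof -
      have ext: "of_pair p \<in> extensional {..<2}" for p
        by (simp add: of_pair_def)
      have "of_pair p \<in> Pi\<^sub>E {..<2} A \<longleftrightarrow> fst p \<in> A 0 \<and> snd p \<in> A 1" for p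
        using ext[of p] by (simp add: PiE_iff numeral_2_eq_2 lessThan_Suc conj_commute)
      then show ?thesis by auto
    qed
    have "emeasure (distr lborel (PiM {..<2} (\<lambda>_. lborel)) of_pair) (Pi\<^sub>E {..<2} A)
        = emeasure (lborel \<Otimes>\<^sub>M lborel) (A 0 \<times> A 1)"
      using A by (subst emeasure_distr) (auto simp: vim lborel_prod intro!: sets_PiM_I_finite)
    also have "\<dots> = (\<Prod>i\<in>{..<2}. emeasure lborel (A i))"
      by (subst lborel.emeasure_pair_measure_Times) (auto simp: numeral_2_eq_2 mult.commute)
    finally show "emeasure (distr lborel (PiM {..<2} (\<lambda>_. lborel)) of_pair) (Pi\<^sub>E {..<2} A)
        = (\<Prod>i\<in>{..<2}. emeasure lborel (A i))" .
  qed auto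
  then show ?thesis by (simp add: Cn_lborel_def)
qed

lemma borel_measurable_Cn_lborel_iff:
  "f \<in> borel_measurable (Cn_lborel 2) \<longleftrightarrow> (\<lambda>p. f (of_pair p)) \<in> borel_measurable borel"
proof
  assume "f \<in> borel_measurable (Cn_lborel 2)"
  then show "(\<lambda>p. f (of_pair p)) \<in> borel_measurable borel"
    using measurable_compose[OF measurable_of_pair] by (auto simp: Cn_lborel_def)
next
  assume "(\<lambda>p. f (of_pair p)) \<in> borel_measurable borel"
  then have "(\<lambda>w. f (of_pair (to_pair w))) \<in> borel_measurable (Cn_lborel 2)"
    using measurable_compose[OF measurable_to_pair] by (auto simp: Cn_lborel_def)
  then show "f \<in> borel_measurable (Cn_lborel 2)"
    by (rule measurable_cong[THEN iffD1, rotated])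
       (simp add: Cn_lborel_def space_PiM topspace_Cn_top)
qed

lemma integrable_Cn_lborel_iff:
  fixes f :: "cpoint \<Rightarrow> 'a::{banach, second_countable_topology}"
  shows "integrable (Cn_lborel 2) f \<longleftrightarrow> integrable lborel (\<lambda>p. f (of_pair p))"
proof (cases "f \<in> borel_measurable (Cn_lborel 2)")
  case True
  then show ?thesis
    unfolding Cn_lborel_2_eq_distr
    by (intro integrable_distr_eq measurable_of_pair) simp
next
  case False
  then show ?thesis
    using borel_measurable_Cn_lborel_iff[of f] by (auto dest: borel_measurable_integrable)
qed

lemma integral_Cn_lborel:
  fixes f :: "cpoint \<Rightarrow> 'a::{banach, second_countable_topology}"
  shows "integral\<^sup>L (Cn_lborel 2) f = (\<integral>p. f (of_pair p) \<partial>lborel)"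
proof (cases "f \<in> borel_measurable (Cn_lborel 2)")
  case True
  then show ?thesis
    unfolding Cn_lborel_2_eq_distr
    by (intro integral_distr measurable_of_pair) simp
next
  case False
  \<comment> \<open>For a function that is not integrable both integrals take the default value
    0.\<close>
  then have "\<not> integrable (Cn_lborel 2) f" by auto
  then show ?thesis
    using integrable_Cn_lborel_iff[of f] by (simp add: not_integrable_integral_eq)
qed

lemma indicator_image_of_pair: "indicator (of_pair ` S) (of_pair p) = indicator S p"
  by (auto simp: indicator_def)

lemma set_integrable_Cn_lborel_iff:
  fixes f :: "cpoint \<Rightarrow> 'a::{banach, second_countable_topology}"
  shows "set_integrable (Cn_lborel 2) (of_pair ` S) f \<longleftrightarrow> set_integrable lborel S (\<lambda>p. f (of_pair p))"
  by (simp add: set_integrable_def integrable_Cn_lborel_iff indicator_image_of_pair)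

lemma set_integral_Cn_lborel:
  fixes f :: "cpoint \<Rightarrow> 'a::{banach, second_countable_topology}"
  shows "set_lebesgue_integral (Cn_lborel 2) (of_pair ` S) f = (LINT p:S|lborel. f (of_pair p))"
  by (simp add: set_lebesgue_integral_def integral_Cn_lborel indicator_image_of_pair)

subsection \<open>The Schwarz-Pick inequality for Jacobians on the bidisc\<close>

definition lin2 :: "complex \<Rightarrow> complex \<Rightarrow> complex \<Rightarrow> complex \<Rightarrow> complex \<times> complex \<Rightarrow> complex \<times> complex" where
  "lin2 a b c d h = (a * fst h + b * snd h, c * fst h + d * snd h)"

definition cscale :: "complex \<Rightarrow> complex \<times> complex \<Rightarrow> complex \<times> complex" where
  "cscale k p = (k * fst p, k * snd p)"

text \<open>A relation rather than a function, so that it also carries differentiability: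
  \<open>lin2\<close> is complex linear, and \<open>\<exists>\<delta>. has_cdet F p \<delta>\<close>
  says that \<open>F\<close> is complex differentiable at \<open>p\<close>.\<close>

definition has_cdet :: "(complex \<times> complex \<Rightarrow> complex \<times> complex) \<Rightarrow> complex \<times> complex \<Rightarrow> complex \<Rightarrow> bool" where
  "has_cdet F p \<delta> \<longleftrightarrow> (\<exists>a b c d. (F has_derivative lin2 a b c d) (at p) \<and> \<delta> = a * d - b * c)"

definition bidisc :: "(complex \<times> complex) set" where
  "bidisc = ball 0 1 \<times> ball 0 1"

lemma lin2_lin2:
  "lin2 a b c d (lin2 a' b' c' d' h) = lin2 (a*a'+b*c') (a*b'+b*d') (c*a'+d*c') (c*b'+d*d') h"
  by (simp add: lin2_def algebra_simps)

lemma lin2_cscale: "lin2 a b c d (cscale k h) = cscale k (lin2 a b c d h)"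
  by (simp add: lin2_def cscale_def algebra_simps)

lemma lin2_eq_iff: "lin2 a b c d = lin2 a' b' c' d' \<longleftrightarrow> a = a' \<and> b = b' \<and> c = c' \<and> d = d'"
proof
  assume *: "lin2 a b c d = lin2 a' b' c' d'"
  show "a = a' \<and> b = b' \<and> c = c' \<and> d = d'"
    using fun_cong[OF *, of "(1, 0)"] fun_cong[OF *, of "(0, 1)"] by (auto simp: lin2_def)
qed auto

lemma lin2_id: "lin2 1 0 0 1 = (\<lambda>h. h)"
  by (auto simp: lin2_def)

lemma has_cdet_compose:
  assumes "has_cdet F p \<delta>" "has_cdet G (F p) \<delta>'"
  shows "has_cdet (\<lambda>q. G (F q)) p (\<delta>' * \<delta>)"
proof -
  obtain a b c d where F: "(F has_derivative lin2 a b c d) (at p)" and \<delta>: "\<delta> = a * d - b * c"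
    using assms(1) by (auto simp: has_cdet_def)
  obtain a' b' c' d' where G: "(G has_derivative lin2 a' b' c' d') (at (F p))" and \<delta>': "\<delta>' = a' * d' - b' * c'"
    using assms(2) by (auto simp: has_cdet_def)
  have "((\<lambda>q. G (F q)) has_derivative lin2 (a'*a+b'*c) (a'*b+b'*d) (c'*a+d'*c) (c'*b+d'*d)) (at p)"
    using diff_chain_at[OF F G] by (simp add: o_def lin2_lin2)
  moreover have "\<delta>' * \<delta> = (a'*a+b'*c) * (c'*b+d'*d) - (a'*b+b'*d) * (c'*a+d'*c)"
    unfolding \<delta> \<delta>' by (simp add: algebra_simps)
  ultimately show ?thesis
    unfolding has_cdet_def by blast
qed

lemma has_derivative_left_inverse_at:
  fixes F G :: "'a::real_normed_vector \<Rightarrow> 'a"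
  assumes "open S" "y \<in> S" "\<And>q. q \<in> S \<Longrightarrow> F (G q) = q"
    and G: "(G has_derivative G') (at y)" and F: "(F has_derivative F') (at (G y))"
  shows "F' (G' h) = h"
proof -
  have "((\<lambda>q. F (G q)) has_derivative (\<lambda>h. F' (G' h))) (at y)"
    using diff_chain_at[OF G F] by (simp add: o_def)
  then have "((\<lambda>q. q) has_derivative (\<lambda>h. F' (G' h))) (at y)"
    by (rule has_derivative_transform_within_open) (use assms in auto)
  then have "(\<lambda>h. F' (G' h)) = (\<lambda>h. h)"
    using has_derivative_unique has_derivative_ident by blast
  then show ?thesis by metis
qed

text \<open>The Moebius map taking \<open>f 0\<close> to 0 reduces this to the Schwarz lemma; its
  derivative at \<open>w = f 0\<close> is \<open>1 / (1 - (cmod w)\<^sup>2)\<close>.\<close>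

lemma Schwarz_Pick_at_0:
  assumes f: "f holomorphic_on ball 0 1" and im: "\<And>z. cmod z < 1 \<Longrightarrow> cmod (f z) < 1"
    and D: "(f has_field_derivative D) (at 0)"
  shows "cmod D \<le> 1 - (cmod (f 0))\<^sup>2"
proof -
  define w where "w = f 0"
  have w: "cmod w < 1" using im[of 0] by (simp add: w_def)
  define m where "m = Moebius_function 0 w"
  have mh: "m holomorphic_on ball 0 1"
    unfolding m_def using Moebius_function_holomorphic[OF w] .
  have hol: "(\<lambda>z. m (f z)) holomorphic_on ball 0 1"
    by (rule holomorphic_on_compose_gen[OF f mh, unfolded o_def]) (use im in auto)
  have 0: "m (f 0) = 0"
    by (simp add: m_def w_def Moebius_function_eq_zero)
  have lt: "cmod (m (f z)) < 1" if "cmod z < 1" for z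
    unfolding m_def by (rule Moebius_function_norm_lt_1[OF w im[OF that]])
  have "cmod (deriv (\<lambda>z. m (f z)) 0) \<le> 1"
    using Schwarz_Lemma(2)[OF hol 0 lt, of 0] by auto
  have pos: "1 - (cmod w)\<^sup>2 > 0"
    using w by (simp add: power_less_one_iff abs_square_less_1)
  have cw: "cnj w * w = of_real ((cmod w)\<^sup>2)"
    by (metis complex_norm_square mult.commute)
  have nz: "1 - cnj w * w \<noteq> 0"
    unfolding cw using pos by (metis eq_iff_diff_eq_0 less_irrefl of_real_1 of_real_eq_iff)
  have "(m has_field_derivative 1 / (1 - cnj w * w)) (at w)"
    unfolding m_def Moebius_function_simple
    by (rule derivative_eq_intros refl nz | simp)+
  then have "((\<lambda>z. m (f z)) has_field_derivative 1 / (1 - cnj w * w) * D) (at 0)"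
    using D by (intro DERIV_chain2[where f = m and g = f]) (auto simp: w_def)
  then have "deriv (\<lambda>z. m (f z)) 0 = D / of_real (1 - (cmod w)\<^sup>2)"
    using DERIV_imp_deriv cw by fastforce
  then have "cmod D / (1 - (cmod w)\<^sup>2) \<le> 1"
    using \<open>cmod (deriv (\<lambda>z. m (f z)) 0) \<le> 1\<close> pos by (simp add: norm_divide del: of_real_diff)
  then show ?thesis
    using pos by (simp add: w_def field_simps)
qed

text \<open>The curve is a Moebius automorphism composed with multiplication by \<open>v\<close>. It
  passes through \<open>z\<close> with the largest speed that Schwarz-Pick allows, in a direction
  that can be prescribed.\<close>

lemma disc_automorphism_curve:
  assumes z: "cmod z < 1" and v: "cmod v = 1"
  obtains \<phi> where "\<And>l. cmod l < 1 \<Longrightarrow> cmod (\<phi> l) < 1" "\<phi> holomorphic_on ball 0 1" "\<phi> 0 = z"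
    "(\<phi> has_field_derivative v * of_real (1 - (cmod z)\<^sup>2)) (at 0)"
proof -
  define \<phi> where "\<phi> l = Moebius_function 0 (-z) (l * v)" for l
  have z': "cmod (-z) < 1" using z by simp
  have "cmod (\<phi> l) < 1" if "cmod l < 1" for l
    unfolding \<phi>_def using that v by (intro Moebius_function_norm_lt_1[OF z']) (auto simp: norm_mult)
  moreover have "\<phi> holomorphic_on ball 0 1"
    unfolding \<phi>_def
    by (rule holomorphic_on_compose_gen[OF _ Moebius_function_holomorphic[OF z'], of "\<lambda>l. l * v", unfolded o_def])
       (use v in \<open>auto intro!: holomorphic_intros simp: norm_mult\<close>)
  moreover have "\<phi> 0 = z"
    by (simp add: \<phi>_def Moebius_function_of_zero)
  moreover have "(\<phi> has_field_derivative v * of_real (1 - (cmod z)\<^sup>2)) (at 0)"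
    unfolding \<phi>_def Moebius_function_simple
    by (rule derivative_eq_intros refl | simp)+
       (simp add: algebra_simps complex_norm_square flip: of_real_power)
  ultimately show ?thesis using that by blast
qed

lemma phase_exists: "\<exists>v. cmod v = 1 \<and> A * v = of_real (cmod A)"
proof (cases "A = 0")
  case False
  then show ?thesis
    by (intro exI[of _ "of_real (cmod A) / A"]) (auto simp: norm_divide)
qed (auto intro: exI[of _ 1])

text \<open>\<open>g\<close> is restricted to a disc in the bidisc whose two coordinates are
  extremal curves through \<open>z\<close>. Their phases \<open>v1\<close>, \<open>v2\<close> are
  chosen so that both terms of the derivative become nonnegative reals; the one-variable bound then
  controls the sum of the moduli.\<close>

lemma bidisc_Schwarz_Pick_row:
  assumes hol: "\<And>p. p \<in> bidisc \<Longrightarrow> \<exists>A B. (g has_derivative (\<lambda>h. A * fst h + B * snd h)) (at p)"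
    and im: "\<And>p. p \<in> bidisc \<Longrightarrow> cmod (g p) < 1"
    and z: "z \<in> bidisc" and D: "(g has_derivative (\<lambda>h. A * fst h + B * snd h)) (at z)"
  shows "cmod A * (1 - (cmod (fst z))\<^sup>2) + cmod B * (1 - (cmod (snd z))\<^sup>2) \<le> 1 - (cmod (g z))\<^sup>2"
proof -
  obtain v1 where v1: "cmod v1 = 1" "A * v1 = of_real (cmod A)" using phase_exists by blast
  obtain v2 where v2: "cmod v2 = 1" "B * v2 = of_real (cmod B)" using phase_exists by blast
  have z1: "cmod (fst z) < 1" and z2: "cmod (snd z) < 1"
    using z by (auto simp: bidisc_def)
  obtain \<phi>1 where 1: "\<And>l. cmod l < 1 \<Longrightarrow> cmod (\<phi>1 l) < 1" "\<phi>1 holomorphic_on ball 0 1" "\<phi>1 0 = fst z"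
    "(\<phi>1 has_field_derivative v1 * of_real (1 - (cmod (fst z))\<^sup>2)) (at 0)"
    using disc_automorphism_curve[OF z1 v1(1)] by blast
  obtain \<phi>2 where 2: "\<And>l. cmod l < 1 \<Longrightarrow> cmod (\<phi>2 l) < 1" "\<phi>2 holomorphic_on ball 0 1" "\<phi>2 0 = snd z"
    "(\<phi>2 has_field_derivative v2 * of_real (1 - (cmod (snd z))\<^sup>2)) (at 0)"
    using disc_automorphism_curve[OF z2 v2(1)] by blast
  define f where "f l = g (\<phi>1 l, \<phi>2 l)" for l
  have chain: "(f has_field_derivative A' * d1 + B' * d2) (at l)"
    if "(\<phi>1 has_field_derivative d1) (at l)" "(\<phi>2 has_field_derivative d2) (at l)"
      "(g has_derivative (\<lambda>h. A' * fst h + B' * snd h)) (at (\<phi>1 l, \<phi>2 l))" for A' B' d1 d2 l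
  proof -
    have P: "((\<lambda>l. (\<phi>1 l, \<phi>2 l)) has_derivative (\<lambda>h. (d1 * h, d2 * h))) (at l)"
      using that(1,2) unfolding has_field_derivative_def by (rule has_derivative_Pair)
    have "(\<lambda>h. A' * (d1 * h) + B' * (d2 * h)) = (*) (A' * d1 + B' * d2)"
      by (auto simp: algebra_simps)
    then show ?thesis
      unfolding has_field_derivative_def f_def
      using diff_chain_at[where f = "\<lambda>l. (\<phi>1 l, \<phi>2 l)" and x = l and g = g, OF P that(3)] by (simp add: o_def)
  qed
  have B: "(\<phi>1 l, \<phi>2 l) \<in> bidisc" if "cmod l < 1" for l
    using 1(1)[OF that] 2(1)[OF that] by (simp add: bidisc_def)
  have "f holomorphic_on ball 0 1"
    unfolding holomorphic_on_open[OF open_ball]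
  proof
    fix l :: complex assume l: "l \<in> ball 0 1"
    obtain A' B' where "(g has_derivative (\<lambda>h. A' * fst h + B' * snd h)) (at (\<phi>1 l, \<phi>2 l))"
      using hol[OF B[of l]] l by auto
    with chain[OF holomorphic_derivI[OF 1(2) open_ball l] holomorphic_derivI[OF 2(2) open_ball l]]
    show "\<exists>f'. (f has_field_derivative f') (at l)" by blast
  qed
  moreover have "cmod (f l) < 1" if "cmod l < 1" for l
    unfolding f_def by (rule im[OF B[OF that]])
  moreover have "(f has_field_derivative A * (v1 * of_real (1 - (cmod (fst z))\<^sup>2)) + B * (v2 * of_real (1 - (cmod (snd z))\<^sup>2))) (at 0)"
    using D by (intro chain 1 2) (simp add: 1(3) 2(3))
  ultimately have "cmod (A * (v1 * of_real (1 - (cmod (fst z))\<^sup>2)) + B * (v2 * of_real (1 - (cmod (snd z))\<^sup>2))) \<le> 1 - (cmod (f 0))\<^sup>2"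
    by (rule Schwarz_Pick_at_0)
  moreover have "A * (v1 * of_real (1 - (cmod (fst z))\<^sup>2)) + B * (v2 * of_real (1 - (cmod (snd z))\<^sup>2))
      = of_real (cmod A * (1 - (cmod (fst z))\<^sup>2) + cmod B * (1 - (cmod (snd z))\<^sup>2))"
    using v1(2) v2(2) by (metis mult.assoc of_real_add of_real_mult)
  ultimately have "\<bar>cmod A * (1 - (cmod (fst z))\<^sup>2) + cmod B * (1 - (cmod (snd z))\<^sup>2)\<bar> \<le> 1 - (cmod (f 0))\<^sup>2"
    by (simp only: norm_of_real)
  then show ?thesis
    by (simp add: f_def 1(3) 2(3))
qed

lemma has_derivative_lin2_components:
  assumes "(T has_derivative lin2 a b c d) F"
  shows "((\<lambda>p. fst (T p)) has_derivative (\<lambda>h. a * fst h + b * snd h)) F"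
    and "((\<lambda>p. snd (T p)) has_derivative (\<lambda>h. c * fst h + d * snd h)) F"
  using has_derivative_fst[OF assms] has_derivative_snd[OF assms] by (simp_all add: lin2_def)

text \<open>Multiplying the two row bounds gives \<open>cmod a * cmod d + cmod b * cmod c\<close>,
  times \<open>s1 * s2\<close>, as the mixed terms; the other two terms are nonnegative, and the
  mixed ones dominate the determinant.\<close>

lemma bidisc_Schwarz_Pick_det:
  assumes hol: "\<And>p. p \<in> bidisc \<Longrightarrow> \<exists>\<delta>. has_cdet T p \<delta>"
    and im: "\<And>p. p \<in> bidisc \<Longrightarrow> T p \<in> bidisc"
    and z: "z \<in> bidisc" and D: "has_cdet T z \<delta>"
  shows "cmod \<delta> * ((1 - (cmod (fst z))\<^sup>2) * (1 - (cmod (snd z))\<^sup>2))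
    \<le> (1 - (cmod (fst (T z)))\<^sup>2) * (1 - (cmod (snd (T z)))\<^sup>2)"
proof -
  obtain a b c d where D: "(T has_derivative lin2 a b c d) (at z)" and \<delta>: "\<delta> = a * d - b * c"
    using D by (auto simp: has_cdet_def)
  define s1 s2 where "s1 = 1 - (cmod (fst z))\<^sup>2" and "s2 = 1 - (cmod (snd z))\<^sup>2"
  have s: "s1 > 0" "s2 > 0"
    using z by (auto simp: s1_def s2_def bidisc_def abs_square_less_1)
  have hol1: "\<exists>A B. ((\<lambda>p. fst (T p)) has_derivative (\<lambda>h. A * fst h + B * snd h)) (at p)"
    and hol2: "\<exists>A B. ((\<lambda>p. snd (T p)) has_derivative (\<lambda>h. A * fst h + B * snd h)) (at p)"
    if p: "p \<in> bidisc" for p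
  proof -
    obtain a b c d where "(T has_derivative lin2 a b c d) (at p)"
      using hol[OF p] by (auto simp: has_cdet_def)
    then show "\<exists>A B. ((\<lambda>p. fst (T p)) has_derivative (\<lambda>h. A * fst h + B * snd h)) (at p)"
      "\<exists>A B. ((\<lambda>p. snd (T p)) has_derivative (\<lambda>h. A * fst h + B * snd h)) (at p)"
      using has_derivative_lin2_components by blast+
  qed
  have row1: "cmod a * s1 + cmod b * s2 \<le> 1 - (cmod (fst (T z)))\<^sup>2"
    unfolding s1_def s2_def
    by (rule bidisc_Schwarz_Pick_row[OF hol1 _ z has_derivative_lin2_components(1)[OF D]])
       (use im in \<open>auto simp: bidisc_def mem_Times_iff\<close>)
  have row2: "cmod c * s1 + cmod d * s2 \<le> 1 - (cmod (snd (T z)))\<^sup>2"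
    unfolding s1_def s2_def
    by (rule bidisc_Schwarz_Pick_row[OF hol2 _ z has_derivative_lin2_components(2)[OF D]])
       (use im in \<open>auto simp: bidisc_def mem_Times_iff\<close>)
  have "cmod \<delta> \<le> cmod a * cmod d + cmod b * cmod c"
    unfolding \<delta> by (metis norm_mult norm_triangle_ineq4)
  then have "cmod \<delta> * (s1 * s2) \<le> (cmod a * cmod d + cmod b * cmod c) * (s1 * s2)"
    using s by (intro mult_right_mono) auto
  also have "\<dots> \<le> (cmod a * s1 + cmod b * s2) * (cmod c * s1 + cmod d * s2)"
  proof -
    have "0 \<le> cmod a * s1 * (cmod c * s1) + cmod b * s2 * (cmod d * s2)"
      using s by simp
    then show ?thesis by (simp add: algebra_simps)
  qed
  also have "\<dots> \<le> (1 - (cmod (fst (T z)))\<^sup>2) * (1 - (cmod (snd (T z)))\<^sup>2)"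
  proof (intro mult_mono row1 row2)
    have "0 \<le> cmod a * s1 + cmod b * s2" using s by simp
    with row1 show "0 \<le> 1 - (cmod (fst (T z)))\<^sup>2" by linarith
    show "0 \<le> cmod c * s1 + cmod d * s2" using s by simp
  qed
  finally show ?thesis by (simp add: s1_def s2_def)
qed

subsection \<open>Rigidity of the Hartogs domain\<close>

text \<open>At \<open>from_bidisc z\<close> the diagonal value of the Bergman kernel of the domain
  is \<open>1 / (pi * bidisc_weight z)\<^sup>2\<close>. Automorphisms with Jacobian of modulus 1
  preserve that value, which suggests this weight; Schwarz-Pick gives the needed inequality without
  the transformation law of kernels.\<close>

definition bidisc_weight :: "complex \<times> complex \<Rightarrow> real" where
  "bidisc_weight z = cmod (1 + fst z) * ((1 - (cmod (fst z))\<^sup>2) * (1 - (cmod (snd z))\<^sup>2))"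

text \<open>The left side has a critical point at \<open>1/3\<close> with value
  \<open>32/27\<close>, hence the double root of the difference.\<close>

lemma cubic_identity: "(1 + r) * (1 - r\<^sup>2) = 32/27 - (r - 1/3)\<^sup>2 * (r + 5/3)" for r :: real
  by (simp add: power2_eq_square field_simps)

text \<open>Uses \<open>cmod (1 + fst z) \<le> 1 + r\<close> with \<open>r = cmod (fst z)\<close>,
  bounds the factor of \<open>snd z\<close> by 1, and weakens \<open>r + 5/3\<close> to
  \<open>5/3\<close> in \<open>cubic_identity\<close>. The explicit quadratic deficit later measures
  the drop in the real direction.\<close>

lemma bidisc_weight_le:
  assumes "z \<in> bidisc"
  shows "bidisc_weight z \<le> 32/27 - 5/3 * (cmod (fst z) - 1/3)\<^sup>2"
proof -
  define r where "r = cmod (fst z)"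
  have r: "0 \<le> r" "r < 1" and s: "cmod (snd z) < 1"
    using assms by (auto simp: r_def bidisc_def)
  have r2: "1 - r\<^sup>2 \<ge> 0" using r by (simp add: abs_square_le_1)
  have "bidisc_weight z \<le> (1 + r) * ((1 - r\<^sup>2) * 1)"
    unfolding bidisc_weight_def r_def[symmetric]
    using r r2 s norm_triangle_ineq[of 1 "fst z"]
    by (intro mult_mono) (auto simp: r_def abs_square_le_1)
  also have "\<dots> = 32/27 - (r - 1/3)\<^sup>2 * (r + 5/3)"
    by (simp add: cubic_identity)
  also have "\<dots> \<le> 32/27 - (r - 1/3)\<^sup>2 * (5/3)"
    using r mult_left_mono[of "5/3" "r + 5/3" "(r - 1/3)\<^sup>2"] by simp
  finally show ?thesis by (simp add: r_def)
qed

text \<open>Equality is forced in every estimate: \<open>r = 1/3\<close>, then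
  \<open>cmod (1 + fst z) = 4/3\<close> and \<open>snd z = 0\<close>. The moduli of
  \<open>fst z\<close> and \<open>1 + fst z\<close> determine the real part by subtraction, and then
  the imaginary part.\<close>

lemma bidisc_weight_max_unique:
  assumes z: "z \<in> bidisc" and w: "32/27 \<le> bidisc_weight z"
  shows "z = (1/3, 0)"
proof -
  define r where "r = cmod (fst z)"
  have "(r - 1/3)\<^sup>2 \<le> 0"
    using bidisc_weight_le[OF z] w unfolding r_def[symmetric] by linarith
  then have r: "r = 1/3" by simp
  define a where "a = cmod (1 + fst z)"
  define q where "q = 1 - (cmod (snd z))\<^sup>2"
  have a: "a \<le> 4/3" "a \<ge> 0"
    using norm_triangle_ineq[of 1 "fst z"] r by (auto simp: a_def r_def)
  have q: "q \<le> 1" "q \<ge> 0"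
    using z by (auto simp: q_def bidisc_def abs_square_le_1)
  have "32/27 \<le> a * ((1 - (1/3)\<^sup>2) * q)"
    using w unfolding bidisc_weight_def a_def q_def r[unfolded r_def] .
  then have aq: "4/3 \<le> a * q" by (simp add: power2_eq_square)
  moreover have "a * q \<le> a * 1" "a * q \<le> 4/3 * q"
    using a q mult_left_mono[of q 1 a] mult_right_mono[of a "4/3" q] by auto
  ultimately have "a = 4/3" "q = 1" using a q by auto
  then have "snd z = 0" by (simp add: q_def)
  moreover have "fst z = 1/3"
  proof -
    have "(cmod (fst z))\<^sup>2 = 1/9" "(cmod (1 + fst z))\<^sup>2 = 16/9"
      unfolding r[unfolded r_def] \<open>a = 4/3\<close>[unfolded a_def] by (simp_all add: power2_eq_square)
    then have "(Re (fst z))\<^sup>2 + (Im (fst z))\<^sup>2 = 1/9" "(1 + Re (fst z))\<^sup>2 + (Im (fst z))\<^sup>2 = 16/9"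
      by (simp_all add: cmod_power2)
    note eqs = this
    then have re: "Re (fst z) = 1/3"
      by (simp add: power2_eq_square algebra_simps)
    have "(1/3)\<^sup>2 + (Im (fst z))\<^sup>2 = 1/9"
      using eqs(1) unfolding re .
    then have "Im (fst z) = 0"
      by (simp add: power_divide)
    with re show ?thesis by (simp add: complex_eq_iff)
  qed
  ultimately show ?thesis by (simp add: prod_eq_iff)
qed

lemma bidisc_weight_center: "bidisc_weight (1/3, 0) = 32/27"
  by (simp add: bidisc_weight_def power2_eq_square norm_divide)

lemma bidisc_weight_imaginary_direction:
  fixes t :: real
  assumes t: "0 \<le> t" "t \<le> 1/10"
  shows "32/27 - 10/9 * t\<^sup>2 - t^4 / 4 \<le> bidisc_weight (1/3 + \<i> * t, 0)"
proof -
  have t2: "0 \<le> t\<^sup>2" "t\<^sup>2 \<le> 1/100"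
    using power_mono[OF t(2,1), of 2] by (auto simp: power2_eq_square)
  have n1: "(cmod (1/3 + \<i> * t))\<^sup>2 = 1/9 + t\<^sup>2"
    unfolding cmod_power2 by (simp add: power2_eq_square)
  have n2: "(cmod (1 + (1/3 + \<i> * t)))\<^sup>2 = 16/9 + t\<^sup>2"
    unfolding cmod_power2 by (simp add: power2_eq_square)
  \<comment> \<open>The Taylor coefficient of \<open>sqrt (16/9 + t\<^sup>2)\<close> at order
    \<open>t\<^sup>2\<close> is \<open>3/8\<close>; the smaller \<open>1/4\<close> is easy to verify
    for \<open>t \<le> 1/10\<close>. It yields \<open>1/4 * 8/9 - 4/3 = - 10/9\<close>, sharp enough
    for the comparison.\<close>
  have "(4/3 + t\<^sup>2/4)\<^sup>2 \<le> (cmod (1 + (1/3 + \<i> * t)))\<^sup>2"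
  proof -
    have "(4/3 + t\<^sup>2/4)\<^sup>2 = 16/9 + t\<^sup>2 * (2/3 + t\<^sup>2/16)"
      by (simp add: power2_eq_square field_simps)
    also have "\<dots> \<le> 16/9 + t\<^sup>2 * 1"
      using t2 by (intro add_left_mono mult_left_mono) auto
    finally show ?thesis unfolding n2 by simp
  qed
  then have "4/3 + t\<^sup>2/4 \<le> cmod (1 + (1/3 + \<i> * t))"
    by (rule power2_le_imp_le) simp
  then have "(4/3 + t\<^sup>2/4) * (8/9 - t\<^sup>2) \<le> cmod (1 + (1/3 + \<i> * t)) * (8/9 - t\<^sup>2)"
    using t2 by (intro mult_right_mono) auto
  also have "\<dots> = bidisc_weight (1/3 + \<i> * t, 0)"
    unfolding bidisc_weight_def fst_conv snd_conv n1 by simp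
  finally show ?thesis
    by (simp add: power2_eq_square power4_eq_xxxx field_simps)
qed

text \<open>The Hessian of the weight at its maximum is not invariant under multiplication by \<open>\<i>\<close>.\<close>

lemma no_quarter_turn_at_weight_max:
  assumes fixed: "T (1/3, 0) = (1/3, 0)"
    and D: "(T has_derivative cscale \<i>) (at (1/3, 0))"
    and im: "\<And>z. z \<in> bidisc \<Longrightarrow> T z \<in> bidisc"
    and mono: "\<And>z. z \<in> bidisc \<Longrightarrow> bidisc_weight z \<le> bidisc_weight (T z)"
  shows False
proof -
  \<comment> \<open>The tolerance \<open>1/10\<close> ensures that the displacement of the image in
    modulus is still at least \<open>9/10 * t\<close>.\<close>
  obtain d where d: "d > 0" and dT: "\<And>y. norm (y - (1/3, 0)) < d \<Longrightarrow>
      norm (T y - T (1/3, 0) - cscale \<i> (y - (1/3, 0))) \<le> (1/10) * norm (y - (1/3, 0))"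
    using D unfolding has_derivative_at_alt by (metis zero_less_divide_1_iff zero_less_numeral)
  define t where "t = min (1/10) (d/2)"
  have t: "0 < t" "t \<le> 1/10" "t < d" using d by (auto simp: t_def)
  define y :: "complex \<times> complex" where "y = (1/3 + \<i> * t, 0)"
  have ny: "norm (y - (1/3, 0)) = t"
    using t by (simp add: y_def norm_Pair norm_mult)
  have "cmod (1/3 + \<i> * t) \<le> 1/3 + t"
    using norm_triangle_ineq[of "1/3" "\<i> * t"] t by (simp add: norm_mult norm_divide)
  then have yB: "y \<in> bidisc" using t by (simp add: y_def bidisc_def)
  define u where "u = fst (T y)"
  define e where "e = T y - (1/3, 0) - cscale \<i> (y - (1/3, 0))"
  have "norm e \<le> t / 10"
    using dT[of y] t by (simp add: ny fixed e_def)
  moreover have "cmod (fst e) \<le> norm e"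
    by (metis norm_fst_le prod.collapse)
  \<comment> \<open>Since \<open>\<i> * (\<i> * t) = - t\<close>, a step in the imaginary direction
    is sent to first order to a step along the real axis, where the weight falls faster.\<close>
  moreover have "fst e = u - of_real (1/3 - t)"
    by (simp add: e_def u_def cscale_def y_def flip: mult.assoc)
  ultimately have "cmod (u - of_real (1/3 - t)) \<le> t / 10"
    by (metis order_trans)
  moreover have "cmod u \<le> cmod (u - of_real (1/3 - t)) + \<bar>1/3 - t\<bar>"
    using norm_triangle_sub[of u "of_real (1/3 - t)"] by (simp only: norm_of_real add.commute)
  ultimately have "cmod u - 1/3 \<le> - (9/10 * t)" using t by simp
  then have "(9/10 * t)\<^sup>2 \<le> (cmod u - 1/3)\<^sup>2"
    using t power_mono[of "9/10 * t" "1/3 - cmod u" 2] by (simp add: power2_commute)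
  then have "bidisc_weight (T y) \<le> 32/27 - 5/3 * (9/10 * t)\<^sup>2"
    using bidisc_weight_le[OF im[OF yB]] by (simp add: u_def)
  moreover have "32/27 - 10/9 * t\<^sup>2 - t^4 / 4 \<le> bidisc_weight y"
    unfolding y_def using t by (intro bidisc_weight_imaginary_direction) auto
  \<comment> \<open>The coefficient on the left is \<open>27/20\<close>, while the right side is at
    most \<open>(10/9 + 1/400) * t\<^sup>2\<close>.\<close>
  ultimately have "5/3 * (9/10 * t)\<^sup>2 \<le> 10/9 * t\<^sup>2 + t^4 / 4"
    using mono[OF yB] by linarith
  moreover have "t^4 / 4 \<le> t\<^sup>2 / 400"
  proof -
    have "t\<^sup>2 * t\<^sup>2 \<le> t\<^sup>2 * (1/100)"
      using power_mono[OF t(2), of 2] t by (intro mult_left_mono) (auto simp: power2_eq_square)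
    then show ?thesis by (simp add: power2_eq_square power4_eq_xxxx)
  qed
  moreover have "t\<^sup>2 > 0" using t by simp
  ultimately show False by (simp add: power_mult_distrib power2_eq_square)
qed

section \<open>The Hartogs domain, its bidisc coordinates, and the rigidity argument\<close>

definition hartogs_dom :: "(complex \<times> complex) set" where
  "hartogs_dom = {p. cmod (fst p) < 1 \<and> cmod (snd p) < cmod (1 + fst p)}"

definition from_bidisc :: "complex \<times> complex \<Rightarrow> complex \<times> complex" where
  "from_bidisc z = (fst z, (1 + fst z) * snd z)"

definition to_bidisc :: "complex \<times> complex \<Rightarrow> complex \<times> complex" where
  "to_bidisc p = (fst p, snd p / (1 + fst p))"

lemma one_plus_nonzero: "cmod a < 1 \<Longrightarrow> 1 + a \<noteq> 0"
  by (metis add.inverse_unique less_irrefl norm_minus_cancel norm_one)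

lemma from_bidisc_mem: "z \<in> bidisc \<Longrightarrow> from_bidisc z \<in> hartogs_dom"
  using one_plus_nonzero[of "fst z"]
  by (auto simp: bidisc_def hartogs_dom_def from_bidisc_def norm_mult)

lemma to_bidisc_mem: "p \<in> hartogs_dom \<Longrightarrow> to_bidisc p \<in> bidisc"
  using one_plus_nonzero[of "fst p"]
  by (auto simp: bidisc_def hartogs_dom_def to_bidisc_def norm_divide divide_simps)

lemma to_bidisc_from_bidisc: "z \<in> bidisc \<Longrightarrow> to_bidisc (from_bidisc z) = z"
  using one_plus_nonzero[of "fst z"] by (auto simp: bidisc_def to_bidisc_def from_bidisc_def)

lemma from_bidisc_to_bidisc: "p \<in> hartogs_dom \<Longrightarrow> from_bidisc (to_bidisc p) = p"
  using one_plus_nonzero[of "fst p"] by (auto simp: hartogs_dom_def to_bidisc_def from_bidisc_def)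

lemma has_derivative_from_bidisc:
  "(from_bidisc has_derivative lin2 1 0 (snd z) (1 + fst z)) (at z)"
  unfolding from_bidisc_def
  by (rule derivative_eq_intros refl)+ (auto simp: lin2_def algebra_simps)

lemma has_derivative_to_bidisc:
  assumes "1 + fst p \<noteq> 0"
  shows "(to_bidisc has_derivative lin2 1 0 (- snd p / (1 + fst p)\<^sup>2) (1 / (1 + fst p))) (at p)"
  unfolding to_bidisc_def
  by (rule derivative_eq_intros refl assms)+ (use assms in \<open>auto simp: lin2_def field_simps power2_eq_square\<close>)

lemma has_derivative_cscale: "(cscale k has_derivative lin2 k 0 0 k) (at p)"
  unfolding cscale_def
  by (rule derivative_eq_intros refl)+ (auto simp: lin2_def)

lemma open_hartogs_dom: "open hartogs_dom"
proof -
  have eq: "hartogs_dom = {p. cmod (fst p) < 1} \<inter> {p. cmod (snd p) < cmod (1 + fst p)}"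
    by (auto simp: hartogs_dom_def)
  show ?thesis
    unfolding eq by (intro open_Int open_Collect_less continuous_intros)
qed

proposition hartogs_dom_not_circular_image:
  assumes FD: "\<And>x. x \<in> D \<Longrightarrow> F x \<in> hartogs_dom" and GD: "\<And>y. y \<in> hartogs_dom \<Longrightarrow> G y \<in> D"
    and FG: "\<And>y. y \<in> hartogs_dom \<Longrightarrow> F (G y) = y" and GF: "\<And>x. x \<in> D \<Longrightarrow> G (F x) = x"
    and circ: "\<And>x. x \<in> D \<Longrightarrow> cscale \<i> x \<in> D"
    and F: "\<And>x. x \<in> D \<Longrightarrow> has_cdet F x c"
    and G: "\<And>y. y \<in> hartogs_dom \<Longrightarrow> \<exists>\<delta>. has_cdet G y \<delta>"
  shows False
proof -
  define T where "T z = to_bidisc (F (cscale \<i> (G (from_bidisc z))))" for z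
  have TB: "T z \<in> bidisc" if "z \<in> bidisc" for z
    unfolding T_def using that by (intro to_bidisc_mem FD circ GD from_bidisc_mem)
  have one_nz: "1 + fst p \<noteq> 0" if "p \<in> hartogs_dom" for p
    using that by (intro one_plus_nonzero) (simp add: hartogs_dom_def)
  have cdet: "has_cdet T z (- (1 + fst z) / (1 + fst (T z)))" if z: "z \<in> bidisc" for z
  proof -
    define y where "y = from_bidisc z"
    have y: "y \<in> hartogs_dom" unfolding y_def using z by (rule from_bidisc_mem)
    obtain g where g: "has_cdet G y g" using G[OF y] by blast
    \<comment> \<open>The chain rule applied to \<open>F (G q) = q\<close> on the open domain; thus
      the constant Jacobian of \<open>F\<close> will cancel against that of
      \<open>G\<close>.\<close>
    have "c * g = 1"
    proof -
      from has_cdet_compose[OF g F[OF GD[OF y]]] obtain a b a' b'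
        where D1: "((\<lambda>q. F (G q)) has_derivative lin2 a b a' b') (at y)" and 1: "c * g = a * b' - b * a'"
        by (auto simp: has_cdet_def)
      have "((\<lambda>q. q) has_derivative lin2 a b a' b') (at y)"
        by (rule has_derivative_transform_within_open[OF D1 open_hartogs_dom y FG])
      then have "lin2 a b a' b' = lin2 1 0 0 1"
        unfolding lin2_id using has_derivative_unique has_derivative_ident by blast
      then show ?thesis using 1 by (simp add: lin2_eq_iff)
    qed
    define x where "x = F (cscale \<i> (G y))"
    have x: "x \<in> hartogs_dom" unfolding x_def using y by (intro FD circ GD)
    have 1: "has_cdet from_bidisc z (1 + fst z)"
      unfolding has_cdet_def using has_derivative_from_bidisc[of z] by (metis diff_zero mult_1 mult_zero_left)
    have 2: "has_cdet (cscale \<i>) p (-1)" for p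
      unfolding has_cdet_def using has_derivative_cscale[of \<i> p]
      by (intro exI[of _ \<i>] exI[of _ 0]) auto
    have 3: "has_cdet to_bidisc x (1 / (1 + fst x))"
      unfolding has_cdet_def using has_derivative_to_bidisc[OF one_nz[OF x]] by (metis diff_zero mult_1 mult_zero_left)
    have "has_cdet T z (1 / (1 + fst x) * (c * (-1 * (g * (1 + fst z)))))"
      unfolding T_def
    proof (intro has_cdet_compose[where G = to_bidisc] has_cdet_compose[where G = F]
        has_cdet_compose[where G = "cscale \<i>"] has_cdet_compose[where G = G] 1 2)
      show "has_cdet G (from_bidisc z) g" using g by (simp add: y_def)
      show "has_cdet F (cscale \<i> (G (from_bidisc z))) c"
        using y by (intro F circ GD) (simp add: y_def)
      show "has_cdet to_bidisc (F (cscale \<i> (G (from_bidisc z)))) (1 / (1 + fst x))"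
        using 3 by (simp add: x_def y_def)
    qed
    moreover have "fst (T z) = fst x"
      by (simp add: T_def x_def y_def to_bidisc_def)
    moreover have "1 / (1 + fst x) * (c * (-1 * (g * (1 + fst z)))) = - (1 + fst z) / (1 + fst x)"
      using \<open>c * g = 1\<close> by (simp add: mult.assoc[symmetric])
    ultimately show ?thesis by simp
  qed
  have mono: "bidisc_weight z \<le> bidisc_weight (T z)" if z: "z \<in> bidisc" for z
  proof -
    have "fst (T z) \<in> ball 0 1" using TB[OF z] by (auto simp: bidisc_def mem_Times_iff)
    then have pos: "cmod (1 + fst (T z)) > 0" using one_plus_nonzero by simp
    have "cmod (- (1 + fst z) / (1 + fst (T z))) * ((1 - (cmod (fst z))\<^sup>2) * (1 - (cmod (snd z))\<^sup>2))
        \<le> (1 - (cmod (fst (T z)))\<^sup>2) * (1 - (cmod (snd (T z)))\<^sup>2)"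
      by (rule bidisc_Schwarz_Pick_det[OF _ TB z cdet[OF z]]) (use cdet in blast)
    moreover have "cmod (- (1 + fst z) / (1 + fst (T z))) = cmod (1 + fst z) / cmod (1 + fst (T z))"
      by (simp only: norm_divide norm_minus_cancel)
    ultimately have "cmod (1 + fst z) * ((1 - (cmod (fst z))\<^sup>2) * (1 - (cmod (snd z))\<^sup>2)) / cmod (1 + fst (T z))
        \<le> (1 - (cmod (fst (T z)))\<^sup>2) * (1 - (cmod (snd (T z)))\<^sup>2)"
      by (simp only: times_divide_eq_left)
    then show ?thesis
      unfolding bidisc_weight_def pos_divide_le_eq[OF pos] by (simp only: mult_ac)
  qed
  define p :: "complex \<times> complex" where "p = (1/3, 0)"
  have p: "p \<in> bidisc" by (simp add: p_def bidisc_def norm_divide)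
  \<comment> \<open>\<open>p\<close> has the maximal weight and \<open>T\<close> does not decrease
    weights, so \<open>T p\<close> is a maximum point as well, and there is only one.\<close>
  have Tp: "T p = p"
    using bidisc_weight_max_unique[OF TB[OF p]] mono[OF p] bidisc_weight_center by (simp add: p_def)
  define y where "y = from_bidisc p"
  have y: "y \<in> hartogs_dom" unfolding y_def using p by (rule from_bidisc_mem)
  have Fy: "F (cscale \<i> (G y)) = y"
    using Tp from_bidisc_to_bidisc[OF FD[OF circ[OF GD[OF y]]]] by (simp add: T_def y_def)
  then have "cscale \<i> (G y) = G y"
    using GF[OF circ[OF GD[OF y]]] by simp
  then have "\<i> * fst (G y) = fst (G y)" "\<i> * snd (G y) = snd (G y)"
    by (auto simp: cscale_def prod_eq_iff)
  then have "fst (G y) = 0" "snd (G y) = 0"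
    by (auto simp: complex_eq_iff)
  \<comment> \<open>The rotation does not move \<open>G y\<close>, so the outer \<open>F\<close> in
    \<open>T\<close> is differentiated at the base point of \<open>dF\<close>, where its derivative
    is inverse to that of \<open>G\<close>.\<close>
  then have i0: "cscale \<i> (G y) = G y" by (simp add: cscale_def prod_eq_iff)
  obtain g1 g2 g3 g4 where dG: "(G has_derivative lin2 g1 g2 g3 g4) (at y)"
    using G[OF y] by (auto simp: has_cdet_def)
  obtain f1 f2 f3 f4 where dF: "(F has_derivative lin2 f1 f2 f3 f4) (at (G y))"
    using F[OF GD[OF y]] by (auto simp: has_cdet_def)
  let ?G = "lin2 g1 g2 g3 g4" and ?F = "lin2 f1 f2 f3 f4"
  have FGid: "?F (?G h) = h" for h
    by (rule has_derivative_left_inverse_at[OF open_hartogs_dom y FG dG dF])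
  define P where "P = lin2 1 0 (snd p) (1 + fst p)"
  have dP: "(from_bidisc has_derivative P) (at p)"
    unfolding P_def by (rule has_derivative_from_bidisc)
  obtain q1 q2 q3 q4 where dQ: "(to_bidisc has_derivative lin2 q1 q2 q3 q4) (at y)"
    using has_derivative_to_bidisc[OF one_nz[OF y]] by blast
  let ?Q = "lin2 q1 q2 q3 q4"
  have QP: "?Q (P h) = h" for h
  proof (rule has_derivative_left_inverse_at[OF _ p _ dP])
    show "open bidisc" by (auto simp: bidisc_def intro: open_Times)
    show "(to_bidisc has_derivative ?Q) (at (from_bidisc p))" using dQ by (simp add: y_def)
  qed (rule to_bidisc_from_bidisc)
  have "(T has_derivative (\<lambda>h. ?Q (?F (lin2 \<i> 0 0 \<i> (?G (P h)))))) (at p)"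
  proof -
    have 1: "((\<lambda>z. G (from_bidisc z)) has_derivative (\<lambda>h. ?G (P h))) (at p)"
      using diff_chain_at[OF dP, of G ?G] dG by (simp add: o_def y_def)
    have 2: "((\<lambda>z. cscale \<i> (G (from_bidisc z))) has_derivative (\<lambda>h. lin2 \<i> 0 0 \<i> (?G (P h)))) (at p)"
      using diff_chain_at[OF 1 has_derivative_cscale] by (simp add: o_def)
    have 3: "((\<lambda>z. F (cscale \<i> (G (from_bidisc z)))) has_derivative (\<lambda>h. ?F (lin2 \<i> 0 0 \<i> (?G (P h))))) (at p)"
      using diff_chain_at[OF 2, of F ?F] dF i0 by (simp add: o_def y_def)
    show ?thesis
      unfolding T_def
      using diff_chain_at[OF 3, of to_bidisc ?Q] dQ Fy by (simp add: o_def y_def)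
  qed
  moreover have "lin2 \<i> 0 0 \<i> h = cscale \<i> h" for h
    by (simp add: lin2_def cscale_def)
  \<comment> \<open>Multiplication by \<open>\<i>\<close> commutes with complex-linear maps, so it
    can be pulled out; the conjugating derivatives then cancel in pairs.\<close>
  ultimately have "(T has_derivative cscale \<i>) (at p)"
    by (simp add: lin2_cscale FGid QP)
  with no_quarter_turn_at_weight_max[of T] Tp TB mono show False
    by (simp add: p_def)
qed

subsection \<open>The Bergman kernel of the Hartogs domain\<close>

definition cdiff_at :: "(complex \<times> complex \<Rightarrow> complex) \<Rightarrow> complex \<times> complex \<Rightarrow> bool" where
  "cdiff_at g p \<longleftrightarrow> (\<exists>A B. (g has_derivative (\<lambda>h. A * fst h + B * snd h)) (at p))"

lemma cdiff_atI:
  assumes "(g has_derivative D) (at p)" "\<And>h. D h = A * fst h + B * snd h"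
  shows "cdiff_at g p"
proof -
  have "D = (\<lambda>h. A * fst h + B * snd h)" using assms(2) by auto
  with assms(1) show ?thesis unfolding cdiff_at_def by blast
qed

lemma cdiff_at_const: "cdiff_at (\<lambda>q. c) p"
  by (rule cdiff_atI[of _ _ _ 0 0]) (auto intro!: derivative_eq_intros)

lemma cdiff_at_fst: "cdiff_at fst p"
  by (rule cdiff_atI[of _ _ _ 1 0]) (auto intro!: derivative_eq_intros)

lemma cdiff_at_snd: "cdiff_at snd p"
  by (rule cdiff_atI[of _ _ _ 0 1]) (auto intro!: derivative_eq_intros)

lemma cdiff_at_add:
  assumes "cdiff_at f p" "cdiff_at g p" shows "cdiff_at (\<lambda>q. f q + g q) p"
proof -
  obtain A B A' B' where "(f has_derivative (\<lambda>h. A * fst h + B * snd h)) (at p)"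
      "(g has_derivative (\<lambda>h. A' * fst h + B' * snd h)) (at p)"
    using assms by (auto simp: cdiff_at_def)
  from has_derivative_add[OF this] show ?thesis
    by (rule cdiff_atI[of _ _ _ "A + A'" "B + B'"]) (simp add: algebra_simps)
qed

lemma cdiff_at_mult:
  assumes "cdiff_at f p" "cdiff_at g p" shows "cdiff_at (\<lambda>q. f q * g q) p"
proof -
  obtain A B A' B' where "(f has_derivative (\<lambda>h. A * fst h + B * snd h)) (at p)"
      "(g has_derivative (\<lambda>h. A' * fst h + B' * snd h)) (at p)"
    using assms by (auto simp: cdiff_at_def)
  from has_derivative_mult[OF this] show ?thesis
    by (rule cdiff_atI[of _ _ _ "f p * A' + A * g p" "f p * B' + B * g p"]) (simp add: algebra_simps)
qed

lemma cdiff_at_divide: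
  assumes "cdiff_at f p" "cdiff_at g p" "g p \<noteq> 0" shows "cdiff_at (\<lambda>q. f q / g q) p"
proof -
  obtain A B A' B' where "(f has_derivative (\<lambda>h. A * fst h + B * snd h)) (at p)"
      "(g has_derivative (\<lambda>h. A' * fst h + B' * snd h)) (at p)"
    using assms by (auto simp: cdiff_at_def)
  from has_derivative_divide'[OF this assms(3)] show ?thesis
    by (rule cdiff_atI[of _ _ _ "(A * g p - f p * A') / (g p * g p)" "(B * g p - f p * B') / (g p * g p)"])
       (use assms(3) in \<open>simp add: field_simps\<close>)
qed

lemma cdiff_at_diff:
  assumes "cdiff_at f p" "cdiff_at g p" shows "cdiff_at (\<lambda>q. f q - g q) p"
  using cdiff_at_add[OF assms(1) cdiff_at_mult[OF cdiff_at_const[of "-1"] assms(2)]] by simp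

lemma cdiff_at_power2:
  assumes "cdiff_at f p" shows "cdiff_at (\<lambda>q. (f q)\<^sup>2) p"
  using cdiff_at_mult[OF assms assms] by (simp add: power2_eq_square)

lemmas cdiff_at_intros = cdiff_at_const cdiff_at_fst cdiff_at_snd cdiff_at_add cdiff_at_diff
  cdiff_at_mult cdiff_at_divide cdiff_at_power2

lemma cdiff_at_imp_continuous_on:
  assumes "\<And>p. p \<in> S \<Longrightarrow> cdiff_at f p" shows "continuous_on S f"
proof (rule continuous_at_imp_continuous_on, rule ballI)
  fix p assume "p \<in> S"
  then obtain D where "(f has_derivative D) (at p)"
    using assms[of p] unfolding cdiff_at_def by blast
  then show "isCont f p" by (rule has_derivative_continuous)
qed

lemma cdiff_at_curve:
  assumes "cdiff_at f (u l, v l)"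
    and "(u has_field_derivative u') (at l)" "(v has_field_derivative v') (at l)"
  shows "\<exists>f'. ((\<lambda>l. f (u l, v l)) has_field_derivative f') (at l)"
proof -
  obtain A B where D: "(f has_derivative (\<lambda>h. A * fst h + B * snd h)) (at (u l, v l))"
    using assms(1) by (auto simp: cdiff_at_def)
  have P: "((\<lambda>l. (u l, v l)) has_derivative (\<lambda>h. (u' * h, v' * h))) (at l)"
    using assms(2,3) unfolding has_field_derivative_def by (rule has_derivative_Pair)
  have "(\<lambda>h. A * (u' * h) + B * (v' * h)) = (*) (A * u' + B * v')"
    by (auto simp: algebra_simps)
  then have "((\<lambda>l. f (u l, v l)) has_field_derivative A * u' + B * v') (at l)"
    unfolding has_field_derivative_def
    using diff_chain_at[where f = "\<lambda>l. (u l, v l)" and x = l and g = f, OF P D] by (simp add: o_def)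
  then show ?thesis ..
qed

text \<open>The kernel \<open>1 / (\<pi>\<^sup>2 (1 - z cnj z')\<^sup>2 (1 - w cnj w')\<^sup>2)\<close> of the bidisc, divided by the Jacobians of
  \<^term>\<open>from_bidisc\<close> at the two points.\<close>

definition hartogs_kernel :: "complex \<times> complex \<Rightarrow> complex \<times> complex \<Rightarrow> complex" where
  "hartogs_kernel p q =
     (1 + fst p) * (1 + cnj (fst q)) /
     (of_real (pi\<^sup>2) * (1 - fst p * cnj (fst q))\<^sup>2 *
      ((1 + fst p) * (1 + cnj (fst q)) - snd p * cnj (snd q))\<^sup>2)"

lemma hartogs_kernel_cnj: "cnj (hartogs_kernel p q) = hartogs_kernel q p"
  by (simp add: hartogs_kernel_def mult_ac)

lemma hartogs_dom_factor_nonzero: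
  assumes "p \<in> hartogs_dom" "q \<in> hartogs_dom"
  shows "1 - fst p * cnj (fst q) \<noteq> 0"
    and "(1 + fst p) * (1 + cnj (fst q)) - snd p * cnj (snd q) \<noteq> 0"
proof -
  have 1: "cmod (fst p) < 1" "cmod (fst q) < 1" "cmod (snd p) < cmod (1 + fst p)" "cmod (snd q) < cmod (1 + fst q)"
    using assms by (auto simp: hartogs_dom_def)
  have "cmod (fst p * cnj (fst q)) < 1 * 1"
    unfolding norm_mult complex_mod_cnj using 1 by (intro mult_strict_mono) auto
  then show "1 - fst p * cnj (fst q) \<noteq> 0"
    by (metis eq_iff_diff_eq_0 less_irrefl mult_1 norm_one)
  have "cmod (1 + cnj (fst q)) = cmod (1 + fst q)"
    by (metis complex_cnj_add complex_cnj_one complex_mod_cnj)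
  then have "cmod (snd p * cnj (snd q)) < cmod ((1 + fst p) * (1 + cnj (fst q)))"
    unfolding norm_mult complex_mod_cnj using 1
    by (intro mult_strict_mono) (auto intro: le_less_trans[OF norm_ge_zero])
  then show "(1 + fst p) * (1 + cnj (fst q)) - snd p * cnj (snd q) \<noteq> 0"
    by (metis eq_iff_diff_eq_0 less_irrefl)
qed

lemma cdiff_at_hartogs_kernel:
  assumes "p \<in> hartogs_dom" "q \<in> hartogs_dom"
  shows "cdiff_at (\<lambda>p. hartogs_kernel p q) p"
  unfolding hartogs_kernel_def
  using hartogs_dom_factor_nonzero[OF assms] by (intro cdiff_at_intros) auto

text \<open>Pulling \<open>(1 + fst p) * (1 + cnj (fst q))\<close> out of the last square exposes
  the bidisc kernel in the coordinates \<open>snd / (1 + fst)\<close>. This form serves for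
  estimates and integration; the defining one is easier to differentiate.\<close>

lemma hartogs_kernel_alt:
  assumes "p \<in> hartogs_dom" "q \<in> hartogs_dom"
  shows "hartogs_kernel p q = 1 / (of_real (pi\<^sup>2) * (1 + fst p) * (1 + cnj (fst q)) * (1 - fst p * cnj (fst q))\<^sup>2
      * (1 - (snd p / (1 + fst p)) * cnj (snd q / (1 + fst q)))\<^sup>2)"
proof -
  define u v where "u = 1 + fst p" and "v = 1 + cnj (fst q)"
  have u: "u \<noteq> 0" and "1 + fst q \<noteq> 0"
    using assms by (auto simp: u_def hartogs_dom_def intro!: one_plus_nonzero)
  then have v: "v \<noteq> 0"
    unfolding v_def by (metis complex_cnj_add complex_cnj_one complex_cnj_zero_iff)
  have cv: "cnj (1 + fst q) = v" by (simp add: v_def)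
  have "u * v - snd p * cnj (snd q) = u * v * (1 - (snd p / u) * (cnj (snd q) / v))"
    using u v by (simp add: field_simps)
  then have "(u * v - snd p * cnj (snd q))\<^sup>2 = (u * v) * (u * v) * (1 - (snd p / u) * (cnj (snd q) / v))\<^sup>2"
    by (simp add: power_mult_distrib power2_eq_square)
  then show ?thesis
    unfolding hartogs_kernel_def complex_cnj_divide cv u_def[symmetric] v_def[symmetric]
    using u v by (simp add: mult_ac)
qed

text \<open>The integrand is the inverse squared modulus of the Jacobian of
  \<open>from_bidisc\<close>. The slice over \<open>a\<close> is a disc of area
  \<open>pi * (cmod (1 + a))\<^sup>2\<close>, so each slice contributes \<open>pi\<close> and the
  total is the volume of the bidisc.\<close>

lemma nn_integral_hartogs_dom:
  "(\<integral>\<^sup>+q. ennreal (indicator hartogs_dom q / (cmod (1 + fst q))\<^sup>2) \<partial>lborel) < \<infinity>"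
proof -
  have [measurable]: "hartogs_dom \<in> sets borel"
    using open_hartogs_dom by simp
  have "(\<lambda>q. ennreal (indicator hartogs_dom q / (cmod (1 + fst q))\<^sup>2)) \<in> borel_measurable (lborel \<Otimes>\<^sub>M lborel)"
  proof -
    have "fst \<in> borel_measurable (borel :: (complex \<times> complex) measure)"
      by (intro borel_measurable_continuous_onI continuous_intros)
    then show ?thesis unfolding lborel_prod by measurable
  qed
  then have "(\<integral>\<^sup>+q. ennreal (indicator hartogs_dom q / (cmod (1 + fst q))\<^sup>2) \<partial>lborel)
      = (\<integral>\<^sup>+a. \<integral>\<^sup>+b. ennreal (indicator hartogs_dom (a, b) / (cmod (1 + a))\<^sup>2) \<partial>lborel \<partial>lborel)"
    unfolding lborel_prod[symmetric] by (subst lborel.nn_integral_fst[symmetric]) auto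
  also have "\<dots> = (\<integral>\<^sup>+a. ennreal pi * indicator (ball 0 1 :: complex set) a \<partial>lborel)"
  proof (rule nn_integral_cong)
    fix a :: complex
    show "(\<integral>\<^sup>+b. ennreal (indicator hartogs_dom (a, b) / (cmod (1 + a))\<^sup>2) \<partial>lborel) = ennreal pi * indicator (ball 0 1) a"
    proof (cases "cmod a < 1")
      case True
      then have nz: "cmod (1 + a) > 0" using one_plus_nonzero[of a] by simp
      have "(\<integral>\<^sup>+b. ennreal (indicator hartogs_dom (a, b) / (cmod (1 + a))\<^sup>2) \<partial>lborel)
          = (\<integral>\<^sup>+b. ennreal (1 / (cmod (1 + a))\<^sup>2) * indicator (ball 0 (cmod (1 + a)) :: complex set) b \<partial>lborel)"
        using True by (intro nn_integral_cong) (auto simp: hartogs_dom_def indicator_def)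
      also have "\<dots> = ennreal (1 / (cmod (1 + a))\<^sup>2) * ennreal (pi * (cmod (1 + a))\<^sup>2)"
        using nz by (subst nn_integral_cmult_indicator) (auto simp: emeasure_ball eval_unit_ball_vol)
      also have "\<dots> = ennreal pi"
        using nz by (subst ennreal_mult[symmetric]) auto
      finally show ?thesis using True by simp
    qed (simp add: hartogs_dom_def)
  qed
  also have "\<dots> = ennreal pi * ennreal pi"
    by (subst nn_integral_cmult_indicator) (auto simp: emeasure_ball eval_unit_ball_vol)
  also have "\<dots> < \<infinity>" by (simp add: ennreal_mult_less_top)
  finally show ?thesis .
qed

text \<open>For fixed \<open>p\<close> both squared factors of the bidisc kernel stay away from 0,
  which leaves the bound \<open>C / cmod (1 + fst q)\<close>; its square is integrable by
  \<open>nn_integral_hartogs_dom\<close>.\<close>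

lemma set_integrable_hartogs_kernel_sq:
  assumes p: "p \<in> hartogs_dom"
  shows "set_integrable lborel hartogs_dom (\<lambda>q. (cmod (hartogs_kernel q p))\<^sup>2)"
proof -
  define \<zeta> where "\<zeta> = snd p / (1 + fst p)"
  have p1: "cmod (fst p) < 1" and \<zeta>: "cmod \<zeta> < 1"
    using to_bidisc_mem[OF p] by (auto simp: to_bidisc_def bidisc_def \<zeta>_def)
  have nzp: "1 + fst p \<noteq> 0" using p1 by (rule one_plus_nonzero)
  define C where "C = 1 / (pi\<^sup>2 * cmod (1 + fst p) * (1 - cmod (fst p))\<^sup>2 * (1 - cmod \<zeta>)\<^sup>2)"
  have bound: "cmod (hartogs_kernel q p) \<le> C / cmod (1 + fst q)" if q: "q \<in> hartogs_dom" for q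
  proof -
    define \<eta> where "\<eta> = snd q / (1 + fst q)"
    have q1: "cmod (fst q) < 1" and \<eta>: "cmod \<eta> < 1"
      using to_bidisc_mem[OF q] by (auto simp: to_bidisc_def bidisc_def \<eta>_def)
    have nzq: "1 + fst q \<noteq> 0" using q1 by (rule one_plus_nonzero)
    have low: "1 - cmod y \<le> cmod (1 - x * cnj y)" if "cmod x < 1" for x y
    proof -
      have "cmod (x * cnj y) \<le> 1 * cmod y"
        unfolding norm_mult complex_mod_cnj using that by (intro mult_right_mono) auto
      then show ?thesis using norm_triangle_ineq2[of 1 "x * cnj y"] by simp
    qed
    have cm: "cmod (1 + cnj (fst p)) = cmod (1 + fst p)"
      by (metis complex_cnj_add complex_cnj_one complex_mod_cnj)
    have ne: "fst q * cnj (fst p) \<noteq> 1" "\<eta> * cnj \<zeta> \<noteq> 1"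
      using low[OF q1, of "fst p"] low[OF \<eta>, of \<zeta>] p1 \<zeta> by auto
    have "cmod (hartogs_kernel q p) = 1 / (pi\<^sup>2 * cmod (1 + fst q) * cmod (1 + fst p) * (cmod (1 - fst q * cnj (fst p)))\<^sup>2
        * (cmod (1 - \<eta> * cnj \<zeta>))\<^sup>2)"
      unfolding hartogs_kernel_alt[OF q p] \<eta>_def[symmetric] \<zeta>_def[symmetric]
      by (simp only: norm_divide norm_mult norm_power cm) (simp add: norm_power)
    also have "\<dots> \<le> 1 / (pi\<^sup>2 * cmod (1 + fst q) * cmod (1 + fst p) * (1 - cmod (fst p))\<^sup>2 * (1 - cmod \<zeta>)\<^sup>2)"
      using p1 \<zeta> nzp nzq low[OF q1] low[OF \<eta>]
      by (intro divide_left_mono mult_mono power_mono mult_pos_pos zero_less_power mult_nonneg_nonneg)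
         (auto simp: ne)
    also have "\<dots> = C / cmod (1 + fst q)"
      by (simp add: C_def)
    finally show ?thesis .
  qed
  have cont: "continuous_on hartogs_dom (\<lambda>q. hartogs_kernel q p)"
    by (intro cdiff_at_imp_continuous_on cdiff_at_hartogs_kernel p)
  have meas: "(\<lambda>q. indicator hartogs_dom q *\<^sub>R (cmod (hartogs_kernel q p))\<^sup>2) \<in> borel_measurable borel"
    using open_hartogs_dom by (intro borel_measurable_continuous_on_indicator continuous_intros cont) auto
  have C: "C \<ge> 0" by (simp add: C_def)
  show ?thesis
    unfolding set_integrable_def
  proof (rule integrableI_bounded)
    have "(\<integral>\<^sup>+q. ennreal (norm (indicator hartogs_dom q *\<^sub>R (cmod (hartogs_kernel q p))\<^sup>2)) \<partial>lborel)
        \<le> (\<integral>\<^sup>+q. ennreal (C\<^sup>2) * ennreal (indicator hartogs_dom q / (cmod (1 + fst q))\<^sup>2) \<partial>lborel)"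
    proof (rule nn_integral_mono)
      fix q
      show "ennreal (norm (indicator hartogs_dom q *\<^sub>R (cmod (hartogs_kernel q p))\<^sup>2))
          \<le> ennreal (C\<^sup>2) * ennreal (indicator hartogs_dom q / (cmod (1 + fst q))\<^sup>2)"
      proof (cases "q \<in> hartogs_dom")
        case True
        from power_mono[OF bound[OF True], of 2] show ?thesis
          using True by (simp add: ennreal_mult[symmetric] power_divide)
      qed simp
    qed
    also have "\<dots> = ennreal (C\<^sup>2) * (\<integral>\<^sup>+q. ennreal (indicator hartogs_dom q / (cmod (1 + fst q))\<^sup>2) \<partial>lborel)"
    proof (rule nn_integral_cmult)
      have "fst \<in> borel_measurable (borel :: (complex \<times> complex) measure)"
        by (intro borel_measurable_continuous_onI continuous_intros)
      moreover have "hartogs_dom \<in> sets borel" using open_hartogs_dom by simp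
      ultimately show "(\<lambda>q. ennreal (indicator hartogs_dom q / (cmod (1 + fst q))\<^sup>2)) \<in> borel_measurable lborel"
        by measurable
    qed
    also have "\<dots> < \<infinity>"
      using nn_integral_hartogs_dom by (simp add: ennreal_mult_less_top)
    finally show "(\<integral>\<^sup>+q. ennreal (norm (indicator hartogs_dom q *\<^sub>R (cmod (hartogs_kernel q p))\<^sup>2)) \<partial>lborel) < \<infinity>" .
  qed (use meas in simp)
qed

text \<open>Fubini and \<open>disc_reproducing\<close> twice: on the slice over \<open>x\<close>, a
  disc of radius \<open>cmod (1 + x)\<close>, the inner integral evaluates \<open>f\<close> at
  \<open>\<zeta> * (1 + x)\<close>; what remains is the one-variable formula for \<open>h\<close> on
  the unit disc.\<close>

proposition hartogs_kernel_reproducing: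
  assumes f: "\<And>q. q \<in> hartogs_dom \<Longrightarrow> cdiff_at f q"
    and sq: "set_integrable lborel hartogs_dom (\<lambda>q. (cmod (f q))\<^sup>2)"
    and p: "p \<in> hartogs_dom"
  shows "(LINT q:hartogs_dom|lborel. f q * hartogs_kernel p q) = f p"
proof -
  define a \<zeta> where "a = fst p" and "\<zeta> = snd p / (1 + a)"
  have a: "cmod a < 1" and \<zeta>: "cmod \<zeta> < 1"
    using to_bidisc_mem[OF p] by (auto simp: to_bidisc_def bidisc_def \<zeta>_def a_def)
  have nza: "1 + a \<noteq> 0" using a by (rule one_plus_nonzero)
  define X where "X q = indicator hartogs_dom q *\<^sub>R (f q * hartogs_kernel p q)" for q
  have cf: "continuous_on hartogs_dom f"
    by (intro cdiff_at_imp_continuous_on f)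
  have ck: "continuous_on hartogs_dom (hartogs_kernel p)"
  proof -
    have "continuous_on hartogs_dom (\<lambda>q. cnj (hartogs_kernel q p))"
      by (intro continuous_intros cdiff_at_imp_continuous_on cdiff_at_hartogs_kernel p)
    then show ?thesis by (simp add: hartogs_kernel_cnj)
  qed
  have Xmeas: "X \<in> borel_measurable borel"
    unfolding X_def using open_hartogs_dom
    by (intro borel_measurable_continuous_on_indicator continuous_intros cf ck) auto
  \<comment> \<open>Cauchy-Schwarz in pointwise form:
    \<open>x * y \<le> x\<^sup>2 + y\<^sup>2\<close>, with both squares integrable.\<close>
  have Xint: "integrable (lborel \<Otimes>\<^sub>M lborel) X"
    unfolding lborel_prod
  proof (rule Bochner_Integration.integrable_bound)
    show "integrable lborel (\<lambda>q. indicator hartogs_dom q *\<^sub>R (cmod (f q))\<^sup>2 + indicator hartogs_dom q *\<^sub>R (cmod (hartogs_kernel q p))\<^sup>2)"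
      using sq set_integrable_hartogs_kernel_sq[OF p] unfolding set_integrable_def
      by (rule Bochner_Integration.integrable_add)
    have "cmod (X q) \<le> norm (indicator hartogs_dom q *\<^sub>R (cmod (f q))\<^sup>2 + indicator hartogs_dom q *\<^sub>R (cmod (hartogs_kernel q p))\<^sup>2)" for q
    proof (cases "q \<in> hartogs_dom")
      case True
      have "cmod (hartogs_kernel p q) = cmod (hartogs_kernel q p)"
        by (metis complex_mod_cnj hartogs_kernel_cnj)
      moreover have "x * y \<le> x\<^sup>2 + y\<^sup>2" if "0 \<le> x" "0 \<le> y" for x y :: real
        using that sum_squares_bound[of x y] mult_nonneg_nonneg[OF that] by linarith
      ultimately show ?thesis
        using True by (simp add: X_def norm_mult)
    qed (simp add: X_def)
    then show "AE q in lborel. cmod (X q) \<le> norm (indicator hartogs_dom q *\<^sub>R (cmod (f q))\<^sup>2 + indicator hartogs_dom q *\<^sub>R (cmod (hartogs_kernel q p))\<^sup>2)"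
      by simp
  qed (use Xmeas in simp)
  have Sint: "integrable (lborel \<Otimes>\<^sub>M lborel) (\<lambda>q. indicator hartogs_dom q *\<^sub>R (cmod (f q))\<^sup>2)"
    using sq by (simp add: set_integrable_def lborel_prod)
  \<comment> \<open>\<open>f\<close> along the image of the disc \<open>w = \<zeta>\<close> of the
    bidisc. The factor \<open>1 + x\<close> is what is left of the squared slice radius
    \<open>(1 + x) * cnj (1 + x)\<close> after cancelling the conjugate factor in the
    kernel.\<close>
  define h where "h x = (1 + x) * f (x, \<zeta> * (1 + x))" for x
  have mem: "(x, \<zeta> * (1 + x)) \<in> hartogs_dom" if "cmod x < 1" for x
  proof -
    have "from_bidisc (x, \<zeta>) \<in> hartogs_dom"
      by (rule from_bidisc_mem) (use that \<zeta> in \<open>simp add: bidisc_def\<close>)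
    then show ?thesis by (simp add: from_bidisc_def mult.commute)
  qed
  have hol_h: "h holomorphic_on ball 0 1"
  proof -
    have "\<exists>f'. ((\<lambda>x. f (x, \<zeta> * (1 + x))) has_field_derivative f') (at x)" if "x \<in> ball 0 1" for x
    proof (rule cdiff_at_curve[where u = "\<lambda>x. x" and v = "\<lambda>x. \<zeta> * (1 + x)"])
      show "cdiff_at f (x, \<zeta> * (1 + x))" using that by (intro f mem) auto
    qed (auto intro!: derivative_eq_intros)
    then have "(\<lambda>x. f (x, \<zeta> * (1 + x))) holomorphic_on ball 0 1"
      by (simp add: holomorphic_on_open)
    then show ?thesis unfolding h_def by (intro holomorphic_intros)
  qed
  define I where "I x = (\<integral>y. X (x, y) \<partial>lborel)" for x
  \<comment> \<open>Stated only for slices on which \<open>f\<close> is square integrable; by Fubini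
    these are almost all of them.\<close>
  have inner: "I x = h x / (of_real pi * (1 + a) * (1 - a * cnj x)\<^sup>2)"
    if x: "cmod x < 1" and int: "integrable lborel (\<lambda>y. indicator hartogs_dom (x, y) *\<^sub>R (cmod (f (x, y)))\<^sup>2)" for x
  proof -
    define R where "R = cmod (1 + x)"
    have nzx: "1 + x \<noteq> 0" using x by (rule one_plus_nonzero)
    then have R: "R > 0" by (simp add: R_def)
    have memy: "(x, y) \<in> hartogs_dom \<longleftrightarrow> y \<in> ball 0 R" for y
      using x by (simp add: hartogs_dom_def R_def)
    let ?g = "\<lambda>y. f (x, y)"
    have hol: "?g holomorphic_on ball 0 R"
      unfolding holomorphic_on_open[OF open_ball]
    proof
      fix y :: complex assume "y \<in> ball 0 R"
      then show "\<exists>f'. (?g has_field_derivative f') (at y)"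
        by (intro cdiff_at_curve[where u = "\<lambda>_. x" and v = "\<lambda>y. y"] f) (auto simp: memy intro!: derivative_eq_intros)
    qed
    have gint: "set_integrable lborel (ball 0 R) ?g"
      unfolding set_integrable_def
    proof (rule Bochner_Integration.integrable_bound)
      have "integrable lborel (\<lambda>y. indicator (ball 0 R) y *\<^sub>R (cmod (f (x, y)))\<^sup>2)"
        using int by (simp add: indicator_def memy)
      moreover have "integrable lborel (indicator (ball 0 R) :: complex \<Rightarrow> real)"
        by (simp add: integrable_real_indicator emeasure_ball R less_imp_le)
      ultimately show "integrable lborel (\<lambda>y. indicator (ball 0 R) y *\<^sub>R (cmod (f (x, y)))\<^sup>2 + indicator (ball 0 R) y)"
        by (rule Bochner_Integration.integrable_add)
      show "(\<lambda>y. indicator (ball 0 R) y *\<^sub>R f (x, y)) \<in> borel_measurable lborel"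
        using borel_measurable_continuous_on_indicator[OF _ holomorphic_on_imp_continuous_on[OF hol]] by simp
      \<comment> \<open>On a slice of finite area this passes from square integrability to
        integrability.\<close>
      have "t \<le> t\<^sup>2 + 1" for t :: real
        using sum_squares_bound[of t "1/2"] by (simp add: power2_eq_square)
      then show "AE y in lborel. norm (indicator (ball 0 R) y *\<^sub>R f (x, y)) \<le> norm (indicator (ball 0 R) y *\<^sub>R (cmod (f (x, y)))\<^sup>2 + indicator (ball 0 R) y)"
        by (auto simp: indicator_def)
    qed
    define z where "z = \<zeta> * (1 + x)"
    have z: "z \<in> ball 0 R"
      using mem[OF x] by (simp add: memy z_def)
    define c where "c = 1 / (of_real (pi\<^sup>2) * (1 + a) * (1 + cnj x) * (1 - a * cnj x)\<^sup>2)"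
    have RR: "of_real (R\<^sup>2) = (1 + x) * cnj (1 + x)"
      by (metis R_def complex_norm_square)
    have nzc: "cnj (1 + x) \<noteq> 0"
      using nzx by (metis complex_cnj_zero_iff)
    have ker: "hartogs_kernel p (x, y) = c * (1 / (1 - z * cnj y / of_real (R\<^sup>2))\<^sup>2)" if "y \<in> ball 0 R" for y
    proof -
      have "z * cnj y / of_real (R\<^sup>2) = \<zeta> * cnj (y / (1 + x))"
      proof -
        have gen: "\<zeta> * u * w / (u * v) = \<zeta> * (w / v)" if "u \<noteq> 0" for u v w
          using that by (cases "v = 0") auto
        show ?thesis
          unfolding RR z_def complex_cnj_divide by (rule gen[OF nzx])
      qed
      moreover have "(x, y) \<in> hartogs_dom" using that by (simp add: memy)
      ultimately show ?thesis
        using hartogs_kernel_alt[OF p, of "(x, y)"] by (simp add: c_def \<zeta>_def a_def)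
    qed
    have "I x = (\<integral>y. c * (indicator (ball 0 R) y *\<^sub>R (f (x, y) / (1 - z * cnj y / of_real (R\<^sup>2))\<^sup>2)) \<partial>lborel)"
      unfolding I_def
    proof (rule Bochner_Integration.integral_cong)
      fix y
      show "X (x, y) = c * (indicator (ball 0 R) y *\<^sub>R (f (x, y) / (1 - z * cnj y / of_real (R\<^sup>2))\<^sup>2))"
        using ker[of y] memy[of y] by (cases "y \<in> ball 0 R") (auto simp: X_def)
    qed simp
    also have "\<dots> = c * (LINT y:ball 0 R|lborel. f (x, y) / (1 - z * cnj y / of_real (R\<^sup>2))\<^sup>2)"
      by (simp only: integral_mult_right_zero set_lebesgue_integral_def)
    also have "\<dots> = c * (of_real (pi * R\<^sup>2) * f (x, z))"
      by (subst disc_reproducing[OF hol z gint]) simp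
    also have "\<dots> = h x / (of_real pi * (1 + a) * (1 - a * cnj x)\<^sup>2)"
    proof -
      have *: "of_real (pi * R\<^sup>2) = of_real pi * ((1 + x) * cnj (1 + x))"
        using RR by (metis of_real_mult)
      show ?thesis
        unfolding * h_def c_def z_def using nzc by (simp add: power2_eq_square)
    qed
    finally show ?thesis .
  qed
  have AEint: "AE x in lborel. integrable lborel (\<lambda>y. indicator hartogs_dom (x, y) *\<^sub>R (cmod (f (x, y)))\<^sup>2)"
    by (rule lborel_pair.AE_integrable_fst'[OF Sint])
  have I0: "I x = 0" if "\<not> cmod x < 1" for x
    using that by (simp add: I_def X_def hartogs_dom_def)
  have AEI: "AE x in lborel. I x = indicator (ball 0 1) x *\<^sub>R (h x / (of_real pi * (1 + a) * (1 - a * cnj x)\<^sup>2))"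
    using AEint by eventually_elim (auto simp: indicator_def inner I0)
  have Iint: "integrable lborel I"
    unfolding I_def by (rule lborel_pair.integrable_fst'[OF Xint])
  have nza': "1 - a * cnj x \<noteq> 0" if "cmod x < 1" for x
    using hartogs_dom_factor_nonzero(1)[OF p mem[OF that]] by (simp add: a_def)
  have cont_h: "continuous_on (ball 0 1) h"
    using hol_h by (rule holomorphic_on_imp_continuous_on)
  have [measurable]: "(\<lambda>x. indicator (ball 0 1) x *\<^sub>R h x) \<in> borel_measurable lborel"
    using borel_measurable_continuous_on_indicator[OF _ cont_h] by simp
  \<comment> \<open>Integrability of \<open>h\<close> is recovered from that of \<open>I\<close>: on
    the disc \<open>h\<close> is almost everywhere \<open>I\<close> times a factor of modulus at
    most \<open>pi * cmod (1 + a) * 4\<close>.\<close>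
  have hint: "set_integrable lborel (ball 0 1) h"
    unfolding set_integrable_def
  proof (rule Bochner_Integration.integrable_bound)
    show "integrable lborel (\<lambda>x. (pi * cmod (1 + a) * 4) *\<^sub>R I x)"
      by (intro integrable_scaleR_right Iint)
    show "AE x in lborel. norm (indicator (ball 0 1) x *\<^sub>R h x) \<le> norm ((pi * cmod (1 + a) * 4) *\<^sub>R I x)"
      using AEI
    proof eventually_elim
      case (elim x)
      show ?case
      proof (cases "cmod x < 1")
        case True
        let ?d = "of_real pi * (1 + a) * (1 - a * cnj x)\<^sup>2"
        have "cmod (a * cnj x) \<le> 1 * 1"
          unfolding norm_mult complex_mod_cnj using True a by (intro mult_mono) auto
        then have "cmod (1 - a * cnj x) \<le> 2"
          using norm_triangle_ineq4[of 1 "a * cnj x"] by simp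
        then have "(cmod (1 - a * cnj x))\<^sup>2 \<le> 2\<^sup>2"
          by (intro power_mono) auto
        then have "cmod ?d \<le> pi * cmod (1 + a) * 4"
          unfolding norm_mult norm_power by (auto intro!: mult_left_mono)
        moreover have "h x = ?d * I x"
          using elim True nza'[OF True] nza by (simp add: indicator_def)
        ultimately show ?thesis
          using True by (simp add: norm_mult[of ?d] mult_right_mono del: norm_mult)
      qed simp
    qed
  qed simp
  have "(LINT q:hartogs_dom|lborel. f q * hartogs_kernel p q) = integral\<^sup>L (lborel \<Otimes>\<^sub>M lborel) X"
    unfolding lborel_prod X_def[abs_def] set_lebesgue_integral_def ..
  also have "\<dots> = (\<integral>x. I x \<partial>lborel)"
    unfolding I_def by (rule lborel_pair.integral_fst'[OF Xint, symmetric])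
  also have "\<dots> = (\<integral>x. (1 / (of_real pi * (1 + a))) * (indicator (ball 0 1) x *\<^sub>R (h x / (1 - a * cnj x / of_real (1\<^sup>2))\<^sup>2)) \<partial>lborel)"
  proof (rule integral_cong_AE)
    show "I \<in> borel_measurable lborel" using Iint by auto
    have "continuous_on (ball 0 1) (\<lambda>x. h x / (1 - a * cnj x / of_real (1\<^sup>2))\<^sup>2)"
      using nza' by (intro continuous_intros cont_h) auto
    from borel_measurable_continuous_on_indicator[OF _ this]
    have "(\<lambda>x. indicator (ball 0 1) x *\<^sub>R (h x / (1 - a * cnj x / of_real (1\<^sup>2))\<^sup>2)) \<in> borel_measurable lborel"
      by simp
    then show "(\<lambda>x. (1 / (of_real pi * (1 + a))) * (indicator (ball 0 1) x *\<^sub>R (h x / (1 - a * cnj x / of_real (1\<^sup>2))\<^sup>2))) \<in> borel_measurable lborel"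
      by (rule borel_measurable_times[OF borel_measurable_const])
    show "AE x in lborel. I x = (1 / (of_real pi * (1 + a))) * (indicator (ball 0 1) x *\<^sub>R (h x / (1 - a * cnj x / of_real (1\<^sup>2))\<^sup>2))"
      using AEI by eventually_elim (auto simp: indicator_def)
  qed
  also have "\<dots> = (1 / (of_real pi * (1 + a))) * (LINT x:ball 0 1|lborel. h x / (1 - a * cnj x / of_real (1\<^sup>2))\<^sup>2)"
    by (simp only: integral_mult_right_zero set_lebesgue_integral_def)
  also have "\<dots> = (1 / (of_real pi * (1 + a))) * (of_real (pi * 1\<^sup>2) * h a)"
    using a by (subst disc_reproducing[OF hol_h _ hint]) auto
  also have "\<dots> = f (a, \<zeta> * (1 + a))"
    using nza by (simp add: h_def)
  also have "(a, \<zeta> * (1 + a)) = p"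
    using nza by (simp add: a_def \<zeta>_def)
  finally show ?thesis .
qed

subsection \<open>The Bergman span at the origin\<close>

lemma bergman_spanI:
  assumes "finite A" "A \<subseteq> multi_indices n"
    and "\<And>z. z \<in> \<Omega> \<Longrightarrow> f z = (\<Sum>\<alpha>\<in>A. c \<alpha> * dbar_multi n \<alpha> (\<lambda>w. K z w) w)"
  shows "f \<in> bergman_span n \<Omega> K w"
  unfolding bergman_span_def using assms by (intro CollectI exI[of _ A] exI[of _ c]) simp

lemma bergman_spanE:
  assumes "f \<in> bergman_span n \<Omega> K w"
  obtains A c where "finite A" "A \<subseteq> multi_indices n"
    "\<And>z. z \<in> \<Omega> \<Longrightarrow> f z = (\<Sum>\<alpha>\<in>A. c \<alpha> * dbar_multi n \<alpha> (\<lambda>w. K z w) w)"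
proof -
  from assms obtain A c where "finite A \<and> A \<subseteq> multi_indices n \<and>
      (\<forall>z\<in>\<Omega>. f z = (\<Sum>\<alpha>\<in>A. c \<alpha> * dbar_multi n \<alpha> (\<lambda>w. K z w) w))"
    unfolding bergman_span_def by blast
  then show thesis by (intro that[of A c]) auto
qed

lemma bergman_span_cong:
  assumes "f \<in> bergman_span n \<Omega> K w" "\<And>z. z \<in> \<Omega> \<Longrightarrow> g z = f z"
  shows "g \<in> bergman_span n \<Omega> K w"
  using assms(1)
proof (rule bergman_spanE)
  fix A c
  assume A: "finite A" "A \<subseteq> multi_indices n"
    "\<And>z. z \<in> \<Omega> \<Longrightarrow> f z = (\<Sum>\<alpha>\<in>A. c \<alpha> * dbar_multi n \<alpha> (\<lambda>w. K z w) w)"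
  show ?thesis
    by (rule bergman_spanI[OF A(1,2)]) (simp only: A(3) assms(2))
qed

lemma bergman_span_add:
  assumes "f \<in> bergman_span n \<Omega> K w" "g \<in> bergman_span n \<Omega> K w"
  shows "(\<lambda>z. f z + g z) \<in> bergman_span n \<Omega> K w"
proof -
  let ?d = "\<lambda>\<alpha> z. dbar_multi n \<alpha> (\<lambda>w. K z w) w"
  obtain A c where A: "finite A" "A \<subseteq> multi_indices n" "\<And>z. z \<in> \<Omega> \<Longrightarrow> f z = (\<Sum>\<alpha>\<in>A. c \<alpha> * ?d \<alpha> z)"
    by (rule bergman_spanE[OF assms(1)]) (rule that)
  obtain B d where B: "finite B" "B \<subseteq> multi_indices n" "\<And>z. z \<in> \<Omega> \<Longrightarrow> g z = (\<Sum>\<alpha>\<in>B. d \<alpha> * ?d \<alpha> z)"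
    by (rule bergman_spanE[OF assms(2)]) (rule that)
  define e where "e \<alpha> = (if \<alpha> \<in> A then c \<alpha> else 0) + (if \<alpha> \<in> B then d \<alpha> else 0)" for \<alpha>
  show ?thesis
  proof (rule bergman_spanI)
    show "finite (A \<union> B)" "A \<union> B \<subseteq> multi_indices n" using A B by auto
    fix z assume z: "z \<in> \<Omega>"
    have "(\<Sum>\<alpha>\<in>A. c \<alpha> * ?d \<alpha> z) = (\<Sum>\<alpha>\<in>A \<union> B. (if \<alpha> \<in> A then c \<alpha> else 0) * ?d \<alpha> z)"
      using A(1) B(1) by (intro sum.mono_neutral_cong_left) auto
    moreover have "(\<Sum>\<alpha>\<in>B. d \<alpha> * ?d \<alpha> z) = (\<Sum>\<alpha>\<in>A \<union> B. (if \<alpha> \<in> B then d \<alpha> else 0) * ?d \<alpha> z)"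
      using A(1) B(1) by (intro sum.mono_neutral_cong_left) auto
    ultimately show "f z + g z = (\<Sum>\<alpha>\<in>A \<union> B. e \<alpha> * ?d \<alpha> z)"
      unfolding A(3)[OF z] B(3)[OF z] e_def by (simp only: distrib_right sum.distrib)
  qed
qed

lemma bergman_span_cmult:
  assumes "f \<in> bergman_span n \<Omega> K w"
  shows "(\<lambda>z. k * f z) \<in> bergman_span n \<Omega> K w"
  using assms
proof (rule bergman_spanE)
  fix A c
  assume A: "finite A" "A \<subseteq> multi_indices n"
    "\<And>z. z \<in> \<Omega> \<Longrightarrow> f z = (\<Sum>\<alpha>\<in>A. c \<alpha> * dbar_multi n \<alpha> (\<lambda>w. K z w) w)"
  show ?thesis
    by (rule bergman_spanI[OF A(1,2), of _ _ "\<lambda>\<alpha>. k * c \<alpha>"]) (simp only: A(3) sum_distrib_left mult.assoc)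
qed

lemma bergman_span_sum:
  assumes "finite I" "\<And>i. i \<in> I \<Longrightarrow> f i \<in> bergman_span n \<Omega> K w"
  shows "(\<lambda>z. \<Sum>i\<in>I. f i z) \<in> bergman_span n \<Omega> K w"
  using assms
proof (induction I rule: finite_induct)
  case empty
  show ?case by (rule bergman_spanI[of "{}"]) auto
next
  case (insert i I)
  then show ?case using bergman_span_add[of "f i"] by simp
qed

lemma bergman_span_base:
  assumes "\<alpha> \<in> multi_indices n"
  shows "(\<lambda>z. dbar_multi n \<alpha> (\<lambda>w. K z w) w) \<in> bergman_span n \<Omega> K w"
  by (rule bergman_spanI[of "{\<alpha>}" _ _ _ "\<lambda>_. 1"]) (use assms in auto)

text \<open>Along \<open>t\<close> and \<open>\<i> * t\<close> the derivatives of
  \<open>H (cnj y)\<close> are \<open>deriv H\<close> and \<open>- \<i> * deriv H\<close>, so the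
  Wirtinger combination is \<open>deriv H\<close> itself.\<close>

lemma dbar_antiholomorphic:
  assumes S: "open S" "cnj x \<in> S" and H: "H holomorphic_on S"
    and G: "\<And>y. cnj y \<in> S \<Longrightarrow> G (w(j := y)) = H (cnj y)"
  shows "dbar j G (w(j := x)) = deriv H (cnj x)"
proof -
  have vd: "vector_derivative (\<lambda>t::real. G (w(j := x + k * of_real t))) (at 0) = cnj k * deriv H (cnj x)" for k
  proof (rule vector_derivative_at)
    have "(H has_field_derivative deriv H (cnj x)) (at (cnj x + cnj k * of_real 0))"
      using holomorphic_derivI[OF H S] by simp
    moreover have "((\<lambda>t::real. cnj x + cnj k * of_real t) has_vector_derivative cnj k) (at 0)"
      by (auto intro!: derivative_eq_intros)
    ultimately have D: "((\<lambda>t. H (cnj x + cnj k * of_real t)) has_vector_derivative cnj k * deriv H (cnj x)) (at 0)"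
      using field_vector_diff_chain_at[of "\<lambda>t. cnj x + cnj k * of_real t" "cnj k" 0 H "deriv H (cnj x)"]
      by (simp add: o_def)
    have "open ((\<lambda>t::real. cnj x + cnj k * of_real t) -` S)"
      by (intro open_vimage S continuous_intros)
    then show "((\<lambda>t. G (w(j := x + k * of_real t))) has_vector_derivative cnj k * deriv H (cnj x)) (at 0)"
      by (rule has_vector_derivative_transform_within_open[OF D]) (use S G in auto)
  qed
  show ?thesis
    using vd[of 1] vd[of \<i>] unfolding dbar_def by simp
qed

text \<open>Turns conjugate derivatives into ordinary complex ones. The identity is carried along on
  the whole open set, since each further derivative needs a neighbourhood.\<close>

lemma dbar_funpow_antiholomorphic:
  assumes S: "open S" and H: "H holomorphic_on S"
    and G: "\<And>y. cnj y \<in> S \<Longrightarrow> G (w(j := y)) = H (cnj y)" and x: "cnj x \<in> S"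
  shows "(dbar j ^^ m) G (w(j := x)) = (deriv ^^ m) H (cnj x)"
  using x
proof (induction m arbitrary: x)
  case 0
  show ?case using G[OF 0] by (simp only: funpow_0)
next
  case (Suc m)
  have "dbar j ((dbar j ^^ m) G) (w(j := x)) = deriv ((deriv ^^ m) H) (cnj x)"
    by (rule dbar_antiholomorphic[OF S Suc.prems holomorphic_higher_deriv[OF H S]]) (rule Suc.IH)
  then show ?case by (simp only: funpow.simps(2) o_apply)
qed

lemma higher_deriv_inverse_square:
  fixes u b C x :: complex
  assumes "u - b * x \<noteq> 0"
  shows "(deriv ^^ n) (\<lambda>x. C / (u - b * x)\<^sup>2) x = C * fact (n + 1) * b ^ n / (u - b * x) ^ (n + 2)"
  using assms
proof (induction n arbitrary: x)
  case 0
  then show ?case by (simp add: power2_eq_square)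
next
  case (Suc n)
  let ?F = "\<lambda>x. C * fact (n + 1) * b ^ n / (u - b * x) ^ (n + 2)"
  have op: "open {x. u - b * x \<noteq> 0}"
    by (intro open_Collect_neq continuous_intros)
  have D: "(?F has_field_derivative C * fact (n + 1) * b ^ n * (of_nat (n + 2) * b) / (u - b * x) ^ (n + 3)) (at x)"
  proof -
    define v where "v = u - b * x"
    have v: "v \<noteq> 0" using Suc.prems by (simp add: v_def)
    have "((\<lambda>x. u - b * x) has_field_derivative - b) (at x)"
      by (auto intro!: derivative_eq_intros)
    from DERIV_power[OF this, of "n + 2"]
    have "((\<lambda>x. (u - b * x) ^ (n + 2)) has_field_derivative of_nat (n + 2) * v ^ (n + 1) * (- b)) (at x)"
      by (simp add: v_def mult_ac)
    moreover have nz: "(u - b * x) ^ (n + 2) \<noteq> 0"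
      using Suc.prems by simp
    ultimately have "(?F has_field_derivative C * fact (n + 1) * b ^ n *
        - (inverse (v ^ (n + 2)) * (of_nat (n + 2) * v ^ (n + 1) * (- b)) * inverse (v ^ (n + 2)))) (at x)"
      unfolding divide_inverse v_def by (intro DERIV_cmult DERIV_inverse')
    moreover have "- (inverse (v ^ (n + 2)) * (of_nat (n + 2) * v ^ (n + 1) * (- b)) * inverse (v ^ (n + 2)))
        = of_nat (n + 2) * b * inverse (v ^ (n + 3))"
    proof -
      have Suc: "n + 3 = Suc (n + 2)" "n + 2 = Suc (n + 1)" by simp_all
      have v': "v ^ (n + 1) \<noteq> 0" using v by simp
      have "inverse (v ^ (n + 2)) * v ^ (n + 1) = inverse v"
        unfolding Suc(2) power_Suc[of v "n + 1"] inverse_mult_distrib mult.assoc field_class.field_inverse[OF v'] by simp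
      moreover have "inverse (v ^ (n + 3)) = inverse v * inverse (v ^ (n + 2))"
        unfolding Suc(1) power_Suc[of v "n + 2"] by (rule inverse_mult_distrib)
      moreover have "- (I * (m * w * (- b)) * I) = m * b * ((I * w) * I)" for I m w
        by (simp add: mult_ac)
      ultimately show ?thesis by (simp only:)
    qed
    ultimately show ?thesis
      by (simp only: v_def divide_inverse mult.assoc)
  qed
  have ev: "eventually (\<lambda>y. (deriv ^^ n) (\<lambda>x. C / (u - b * x)\<^sup>2) y = ?F y) (nhds x)"
  proof -
    have "eventually (\<lambda>y. y \<in> {x. u - b * x \<noteq> 0}) (nhds x)"
      by (rule eventually_nhds_in_open[OF op]) (use Suc.prems in simp)
    then show ?thesis by (rule eventually_mono) (use Suc.IH in blast)
  qed
  have "((deriv ^^ n) (\<lambda>x. C / (u - b * x)\<^sup>2) has_field_derivative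
      C * fact (n + 1) * b ^ n * (of_nat (n + 2) * b) / (u - b * x) ^ (n + 3)) (at x)"
    by (subst DERIV_cong_ev[OF refl ev refl]) (rule D)
  from DERIV_imp_deriv[OF this]
  have "(deriv ^^ Suc n) (\<lambda>x. C / (u - b * x)\<^sup>2) x
      = C * fact (n + 1) * b ^ n * (of_nat (n + 2) * b) / (u - b * x) ^ (n + 3)"
    by (simp only: funpow.simps(2) o_apply)
  also have "C * fact (n + 1) * b ^ n * (of_nat (n + 2) * b) = C * (of_nat (n + 2) * fact (n + 1)) * b ^ Suc n"
    by (simp only: power_Suc mult_ac)
  also have "of_nat (n + 2) * fact (n + 1) = (fact (Suc n + 1) :: complex)"
    using fact_Suc[of "n + 1", where 'a = complex] by (simp only: add_Suc Suc_eq_plus1 add.assoc one_add_one)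
  also have "n + 3 = Suc n + 2" by simp
  finally show ?case .
qed

definition Cn_hartogs_dom :: "cpoint set" where
  "Cn_hartogs_dom = of_pair ` hartogs_dom"

definition Cn_hartogs_kernel :: "cpoint \<Rightarrow> cpoint \<Rightarrow> complex" where
  "Cn_hartogs_kernel z w = hartogs_kernel (to_pair z) (to_pair w)"

definition pair_index :: "nat \<Rightarrow> nat \<Rightarrow> nat \<Rightarrow> nat" where
  "pair_index i j = (\<lambda>k\<in>{..<2}. if k = 0 then i else j)"

lemma pair_index_in_multi_indices: "pair_index i j \<in> multi_indices 2"
  by (simp add: pair_index_def multi_indices_def)

text \<open>The recursion works from the highest coordinate down, so the derivatives in the second
  variable act first.\<close>

lemma dbar_multi_2:
  "dbar_multi 2 (pair_index i j) g w = (dbar 0 ^^ i) ((dbar 1 ^^ j) g) w"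
  by (simp add: numeral_2_eq_2 pair_index_def)

text \<open>In the conjugate of the second variable the kernel is an inverse square, differentiated
  explicitly. At 0 the result splits into a product \<open>P * Q\<close> in the conjugate of the
  first variable, to which the Leibniz rule applies.\<close>

lemma dbar_multi_hartogs_kernel:
  fixes i j :: nat
  assumes p: "(a, b) \<in> hartogs_dom"
  defines "c \<equiv> fact (j + 1) / (of_real (pi\<^sup>2))"
  shows "dbar_multi 2 (pair_index i j) (Cn_hartogs_kernel (of_pair (a, b))) (of_pair (0, 0)) =
      c * (b ^ j / (1 + a) ^ (j + 1)) *
        (\<Sum>l=0..i. of_nat (i choose l) * (deriv ^^ l) (\<lambda>x. 1 / (1 + x) ^ (j + 1)) 0 * (fact (i - l + 1) * a ^ (i - l)))"
proof -
  have a: "cmod a < 1" using p by (simp add: hartogs_dom_def)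
  have nza: "1 + a \<noteq> 0" using a by (rule one_plus_nonzero)
  define g where "g = Cn_hartogs_kernel (of_pair (a, b))"
  define P where "P x = 1 / (1 + x) ^ (j + 1)" for x :: complex
  define C where "C = c * (b ^ j / (1 + a) ^ (j + 1))"
  define Q where "Q x = C / (1 - a * x)\<^sup>2" for x
  have nzax: "1 - a * x \<noteq> 0" if "cmod x < 1" for x
  proof -
    have "cmod (a * x) < 1 * 1"
      unfolding norm_mult using a that by (intro mult_strict_mono) auto
    then show ?thesis by (metis eq_iff_diff_eq_0 less_irrefl mult_1 norm_one)
  qed
  \<comment> \<open>Needed on the whole unit disc, not only at 0, because it is differentiated in
    the first variable next. One \<open>u\<close> of the numerator cancels, hence the exponent
    \<open>j + 1\<close> in \<open>P\<close> and \<open>C\<close>.\<close>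
  have step1: "(dbar 1 ^^ j) g (of_pair (x, 0)) = P (cnj x) * Q (cnj x)" if x: "cmod x < 1" for x
  proof -
    define u where "u = (1 + a) * (1 + cnj x)"
    have nzx: "1 + cnj x \<noteq> 0" using x by (intro one_plus_nonzero) simp
    have u: "u \<noteq> 0" using nza nzx by (simp add: u_def)
    define D where "D = u / (of_real (pi\<^sup>2) * (1 - a * cnj x)\<^sup>2)"
    let ?H = "\<lambda>y. D / (u - b * y)\<^sup>2"
    let ?S = "{y. u - b * y \<noteq> 0}"
    have "(dbar 1 ^^ j) g ((of_pair (x, 0))(1 := 0)) = (deriv ^^ j) ?H (cnj 0)"
    proof (rule dbar_funpow_antiholomorphic)
      show "open ?S" by (intro open_Collect_neq continuous_intros)
      show "?H holomorphic_on ?S" by (intro holomorphic_intros) auto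
      show "g ((of_pair (x, 0))(1 := y)) = ?H (cnj y)" for y
        by (simp add: g_def Cn_hartogs_kernel_def of_pair_upd_1 hartogs_kernel_def D_def u_def)
    qed (use u in simp)
    also have "\<dots> = D * fact (j + 1) * b ^ j / u ^ (j + 2)"
      using higher_deriv_inverse_square[of u b 0 j D] u by simp
    also have "\<dots> = P (cnj x) * Q (cnj x)"
      using u nza nzx
      by (simp add: P_def Q_def C_def c_def D_def u_def power_mult_distrib mult_ac)
    finally show ?thesis
      by (simp add: of_pair_upd_1)
  qed
  have holP: "P holomorphic_on ball 0 1"
    unfolding P_def using one_plus_nonzero by (intro holomorphic_intros) auto
  have holQ: "Q holomorphic_on ball 0 1"
    unfolding Q_def using nzax by (intro holomorphic_intros) auto
  have "(dbar 0 ^^ i) ((dbar 1 ^^ j) g) ((of_pair (0, 0))(0 := 0)) = (deriv ^^ i) (\<lambda>x. P x * Q x) (cnj 0)"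
    by (rule dbar_funpow_antiholomorphic[where S = "ball 0 1"])
       (use step1 in \<open>auto intro!: holomorphic_intros holP holQ simp: of_pair_upd_0\<close>)
  also have "\<dots> = (\<Sum>l=0..i. of_nat (i choose l) * (deriv ^^ l) P 0 * (deriv ^^ (i - l)) Q 0)"
    using higher_deriv_mult[OF holP holQ, of 0 i] by simp
  also have "\<dots> = (\<Sum>l=0..i. of_nat (i choose l) * (deriv ^^ l) P 0 * (C * fact (i - l + 1) * a ^ (i - l)))"
    using higher_deriv_inverse_square[of 1 a 0 _ C] by (simp add: Q_def[abs_def])
  also have "\<dots> = C * (\<Sum>l=0..i. of_nat (i choose l) * (deriv ^^ l) P 0 * (fact (i - l + 1) * a ^ (i - l)))"
    by (simp only: sum_distrib_left mult_ac)
  finally show ?thesis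
    by (simp add: dbar_multi_2 g_def of_pair_upd_0 P_def[abs_def] C_def)
qed

text \<open>The span contains \<open>b ^ j / (1 + a) ^ (j + 1) * a ^ i\<close>: the derivatives of the kernel are triangular
  in \<open>i\<close> with respect to these functions.\<close>

lemma bergman_span_twisted_monomial:
  "(\<lambda>z. (z 1) ^ j / (1 + z 0) ^ (j + 1) * (z 0) ^ i)
    \<in> bergman_span 2 Cn_hartogs_dom Cn_hartogs_kernel (of_pair (0, 0))"
proof (induction i rule: less_induct)
  case (less i)
  let ?V = "bergman_span 2 Cn_hartogs_dom Cn_hartogs_kernel (of_pair (0, 0))"
  let ?m = "\<lambda>i z. (z 1 :: complex) ^ j / (1 + z (0::nat)) ^ (j + 1) * (z 0) ^ i"
  define c :: complex where "c = fact (j + 1) / of_real (pi\<^sup>2)"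
  \<comment> \<open>\<open>e l\<close> is the coefficient of \<open>a ^ (i - l)\<close> in the
    derivative of order \<open>(i, j)\<close>. The leading one, \<open>e 0\<close>, is
    \<open>fact (i + 1)\<close>; being nonzero, it allows solving for the top power in terms of
    lower ones.\<close>
  define e :: "nat \<Rightarrow> complex" where
    "e l = of_nat (i choose l) * (deriv ^^ l) (\<lambda>x. 1 / (1 + x) ^ (j + 1)) 0 * fact (i - l + 1)" for l
  have c: "c \<noteq> 0"
    using fact_nonzero[of "j + 1", where 'a = complex] by (simp add: c_def del: fact_Suc)
  have e0: "e 0 \<noteq> 0"
    using fact_nonzero[of "i + 1", where 'a = complex] by (simp add: e_def del: fact_Suc)
  define d where "d z = dbar_multi 2 (pair_index i j) (Cn_hartogs_kernel z) (of_pair (0, 0))" for z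
  have d: "d \<in> ?V"
    unfolding d_def by (rule bergman_span_base[OF pair_index_in_multi_indices])
  have eq: "?m i z = (1 / (c * e 0)) * d z + (\<Sum>l=1..i. (- e l / e 0) * ?m (i - l) z)" if zD: "z \<in> Cn_hartogs_dom" for z
  proof -
    obtain a b where z: "z = of_pair (a, b)" "(a, b) \<in> hartogs_dom"
      using zD by (auto simp: Cn_hartogs_dom_def)
    define M where "M = b ^ j / (1 + a) ^ (j + 1)"
    have "d z = c * M * (\<Sum>l=0..i. e l * a ^ (i - l))"
      unfolding d_def z(1) dbar_multi_hartogs_kernel[OF z(2)] by (simp add: c_def M_def e_def mult.assoc)
    also have "(\<Sum>l=0..i. e l * a ^ (i - l)) = e 0 * a ^ i + (\<Sum>l=1..i. e l * a ^ (i - l))"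
      by (simp add: sum.atLeast_Suc_atMost)
    finally have dz: "d z = c * M * (e 0 * a ^ i + (\<Sum>l=1..i. e l * a ^ (i - l)))" .
    have "(1 / (c * e 0)) * (c * M * (e 0 * x + S)) = M * x + (M / e 0) * S" for x S
      using c e0 by (simp add: field_simps)
    moreover have "(M / e 0) * (\<Sum>l=1..i. e l * a ^ (i - l)) = (\<Sum>l=1..i. (e l / e 0) * (M * a ^ (i - l)))"
      unfolding sum_distrib_left by (rule sum.cong) simp_all
    ultimately have "(1 / (c * e 0)) * d z = M * a ^ i + (\<Sum>l=1..i. (e l / e 0) * (M * a ^ (i - l)))"
      unfolding dz by (simp only:)
    moreover have "?m k z = M * a ^ k" for k
      by (simp add: z(1) M_def)
    ultimately show ?thesis
      by (simp only: minus_divide_left[symmetric] mult_minus_left sum_negf) simp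
  qed
  have "(\<lambda>z. (- e l / e 0) * ?m (i - l) z) \<in> ?V" if "l \<in> {1..i}" for l
  proof -
    have "i - l < i" using that by auto
    from bergman_span_cmult[OF less.IH[OF this]] show ?thesis .
  qed
  then have "(\<lambda>z. \<Sum>l=1..i. (- e l / e 0) * ?m (i - l) z) \<in> ?V"
    by (rule bergman_span_sum[OF finite_atLeastAtMost])
  from bergman_span_add[OF bergman_span_cmult[OF d] this]
  have "(\<lambda>z. (1 / (c * e 0)) * d z + (\<Sum>l=1..i. (- e l / e 0) * ?m (i - l) z)) \<in> ?V" .
  from bergman_span_cong[OF this eq] show ?case .
qed

text \<open>The denominator is removed by multiplying with \<open>(1 + z 0) ^ (j + 1)\<close>: its
  binomial expansion only raises the power of \<open>z 0\<close>, and every twisted monomial with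
  the same \<open>j\<close> is in the span.\<close>

lemma bergman_span_monomial:
  "(\<lambda>z. (z 0) ^ i * (z 1) ^ j) \<in> bergman_span 2 Cn_hartogs_dom Cn_hartogs_kernel (of_pair (0, 0))"
proof -
  let ?m = "\<lambda>i z. (z 1 :: complex) ^ j / (1 + z (0::nat)) ^ (j + 1) * (z 0) ^ i"
  have "(\<lambda>z. \<Sum>k\<le>j + 1. of_nat (j + 1 choose k) * ?m (k + i) z)
      \<in> bergman_span 2 Cn_hartogs_dom Cn_hartogs_kernel (of_pair (0, 0))"
    by (rule bergman_span_sum[OF finite_atMost], rule bergman_span_cmult, rule bergman_span_twisted_monomial)
  then show ?thesis
  proof (rule bergman_span_cong)
    fix z assume "z \<in> Cn_hartogs_dom"
    then have nz: "1 + z 0 \<noteq> 0"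
      by (auto simp: Cn_hartogs_dom_def hartogs_dom_def intro!: one_plus_nonzero)
    define s where "s = z 0"
    define M where "M = (z 1) ^ j / (1 + s) ^ (j + 1)"
    have M: "M * (s + 1) ^ (j + 1) = (z 1) ^ j"
    proof -
      have "x / y * y = x" if "y \<noteq> 0" for x y :: complex
        using that by simp
      moreover have "(1 + s) ^ (j + 1) \<noteq> 0" using nz by (simp add: s_def)
      ultimately show ?thesis
        unfolding M_def add.commute[of s 1] by blast
    qed
    have "(\<Sum>k\<le>j + 1. of_nat (j + 1 choose k) * (M * s ^ (k + i))) = M * s ^ i * (\<Sum>k\<le>j + 1. of_nat (j + 1 choose k) * s ^ k * 1 ^ (j + 1 - k))"
      by (simp only: sum_distrib_left power_add power_one mult_1_left mult_1_right mult_ac)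
    also have "\<dots> = M * s ^ i * (s + 1) ^ (j + 1)"
      by (simp only: binomial_ring)
    also have "\<dots> = s ^ i * (M * (s + 1) ^ (j + 1))"
      by (simp only: mult_ac)
    also have "\<dots> = (z 0) ^ i * (z 1) ^ j"
      unfolding M unfolding s_def ..
    finally show "(z 0) ^ i * (z 1) ^ j = (\<Sum>k\<le>j + 1. of_nat (j + 1 choose k) * ?m (k + i) z)"
      by (simp only: M_def s_def)
  qed
qed

lemma holomorphic_polynomials_subset_bergman_span:
  "holomorphic_polynomials 2 \<subseteq> bergman_span 2 Cn_hartogs_dom Cn_hartogs_kernel (of_pair (0, 0))"
proof
  fix f assume "f \<in> holomorphic_polynomials 2"
  then obtain A c where A: "finite A"
      "\<And>z. z \<in> topspace (Cn_top 2) \<Longrightarrow> f z = (\<Sum>\<alpha>\<in>A. c \<alpha> * (\<Prod>i<2. z i ^ \<alpha> i))"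
    by (auto simp: holomorphic_polynomials_def)
  have "(\<lambda>z. \<Sum>\<alpha>\<in>A. c \<alpha> * ((z 0) ^ \<alpha> 0 * (z 1) ^ \<alpha> 1)) \<in> bergman_span 2 Cn_hartogs_dom Cn_hartogs_kernel (of_pair (0, 0))"
    by (rule bergman_span_sum[OF A(1)], rule bergman_span_cmult, rule bergman_span_monomial)
  then show "f \<in> bergman_span 2 Cn_hartogs_dom Cn_hartogs_kernel (of_pair (0, 0))"
  proof (rule bergman_span_cong)
    fix z assume "z \<in> Cn_hartogs_dom"
    then have "z \<in> topspace (Cn_top 2)" by (auto simp: Cn_hartogs_dom_def)
    then show "f z = (\<Sum>\<alpha>\<in>A. c \<alpha> * ((z 0) ^ \<alpha> 0 * (z 1) ^ \<alpha> 1))"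
      by (subst A(2)) (simp_all add: numeral_2_eq_2)
  qed
qed

section \<open>The domain as a 1-point QDP in the sense of the definitions\<close>

lemma Cn_differentiable_iff_cdiff_at:
  "Cn_differentiable 2 f (of_pair p) \<longleftrightarrow> cdiff_at (\<lambda>q. f (of_pair q)) p"
  by (simp add: Cn_differentiable_of_pair cdiff_at_def)

lemma is_bergman_kernel_hartogs: "is_bergman_kernel 2 Cn_hartogs_dom Cn_hartogs_kernel"
  unfolding is_bergman_kernel_def
proof (intro conjI ballI)
  fix w assume "w \<in> Cn_hartogs_dom"
  then obtain q where q: "w = of_pair q" "q \<in> hartogs_dom"
    by (auto simp: Cn_hartogs_dom_def)
  show "Cn_holomorphic 2 Cn_hartogs_dom (\<lambda>z. Cn_hartogs_kernel z w)"
    using q cdiff_at_hartogs_kernel[of _ q]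
    by (auto simp: Cn_holomorphic_def Cn_hartogs_dom_def Cn_differentiable_iff_cdiff_at Cn_hartogs_kernel_def)
next
  fix z assume "z \<in> Cn_hartogs_dom"
  then obtain p where p: "z = of_pair p" "p \<in> hartogs_dom"
    by (auto simp: Cn_hartogs_dom_def)
  have "Cn_holomorphic 2 Cn_hartogs_dom (\<lambda>w. cnj (Cn_hartogs_kernel z w))"
    using p cdiff_at_hartogs_kernel[of _ p]
    by (auto simp: Cn_holomorphic_def Cn_hartogs_dom_def Cn_differentiable_iff_cdiff_at Cn_hartogs_kernel_def hartogs_kernel_cnj)
  moreover have "set_integrable (Cn_lborel 2) Cn_hartogs_dom (\<lambda>w. (cmod (cnj (Cn_hartogs_kernel z w)))\<^sup>2)"
    using set_integrable_hartogs_kernel_sq[OF p(2)]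
    by (simp add: Cn_hartogs_dom_def set_integrable_Cn_lborel_iff Cn_hartogs_kernel_def p(1) hartogs_kernel_cnj del: complex_mod_cnj)
  ultimately show "(\<lambda>w. cnj (Cn_hartogs_kernel z w)) \<in> bergman_space 2 Cn_hartogs_dom"
    by (simp add: bergman_space_def del: complex_mod_cnj)
next
  fix f z assume f: "f \<in> bergman_space 2 Cn_hartogs_dom" and "z \<in> Cn_hartogs_dom"
  then obtain p where p: "z = of_pair p" "p \<in> hartogs_dom"
    by (auto simp: Cn_hartogs_dom_def)
  have "cdiff_at (\<lambda>q. f (of_pair q)) q" if "q \<in> hartogs_dom" for q
    using f that by (auto simp: bergman_space_def Cn_holomorphic_def Cn_hartogs_dom_def Cn_differentiable_iff_cdiff_at)
  moreover have "set_integrable lborel hartogs_dom (\<lambda>q. (cmod (f (of_pair q)))\<^sup>2)"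
    using f by (simp add: bergman_space_def Cn_hartogs_dom_def set_integrable_Cn_lborel_iff)
  ultimately show "set_lebesgue_integral (Cn_lborel 2) Cn_hartogs_dom (\<lambda>w. f w * Cn_hartogs_kernel z w) = f z"
    using hartogs_kernel_reproducing[of "\<lambda>q. f (of_pair q)" p] p
    by (simp add: Cn_hartogs_dom_def set_integral_Cn_lborel Cn_hartogs_kernel_def)
qed

lemma Cn_domain_hartogs: "Cn_domain 2 Cn_hartogs_dom"
proof -
  have eq: "hartogs_dom = from_bidisc ` bidisc"
  proof
    show "from_bidisc ` bidisc \<subseteq> hartogs_dom"
      using from_bidisc_mem by blast
    show "hartogs_dom \<subseteq> from_bidisc ` bidisc"
    proof
      fix p assume p: "p \<in> hartogs_dom"
      show "p \<in> from_bidisc ` bidisc"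
        by (rule image_eqI[where x = "to_bidisc p"]) (simp_all only: from_bidisc_to_bidisc[OF p] to_bidisc_mem[OF p])
    qed
  qed
  have "connected bidisc"
    unfolding bidisc_def by (intro connected_Times connected_ball)
  moreover have "continuous_on bidisc from_bidisc"
    unfolding from_bidisc_def by (intro continuous_intros)
  ultimately have "connected hartogs_dom"
    unfolding eq by (intro connected_continuous_image)
  then have "connectedin (Cn_top 2) Cn_hartogs_dom"
    unfolding Cn_hartogs_dom_def
    by (intro connectedin_continuous_map_image[OF continuous_map_of_pair]) simp
  moreover have "(0, 0) \<in> hartogs_dom" by (simp add: hartogs_dom_def)
  ultimately show ?thesis
    unfolding Cn_domain_def using openin_Cn_top_image_of_pair[OF open_hartogs_dom]
    by (auto simp: Cn_hartogs_dom_def)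
qed

lemma one_point_QDP_hartogs: "one_point_QDP 2 Cn_hartogs_dom"
proof -
  have "of_pair (0, 0) \<in> Cn_hartogs_dom"
    by (simp add: Cn_hartogs_dom_def hartogs_dom_def)
  with holomorphic_polynomials_subset_bergman_span
  have "\<exists>w0\<in>Cn_hartogs_dom. holomorphic_polynomials 2 \<subseteq> bergman_span 2 Cn_hartogs_dom Cn_hartogs_kernel w0" ..
  with is_bergman_kernel_hartogs
  have "is_bergman_kernel 2 Cn_hartogs_dom Cn_hartogs_kernel \<and>
      (\<exists>w0\<in>Cn_hartogs_dom. holomorphic_polynomials 2 \<subseteq> bergman_span 2 Cn_hartogs_dom Cn_hartogs_kernel w0)" ..
  then show ?thesis
    unfolding one_point_QDP_def using Cn_domain_hartogs by (intro conjI[OF _ exI[of _ Cn_hartogs_kernel]])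
qed

subsection \<open>Circular domains in \<open>C\<^sup>2\<close>\<close>

lemma det_mat_2:
  "Determinant.det (Matrix.mat 2 2 f) = f (0, 0) * f (1, 1) - f (0, 1) * (f (1, 0) :: 'a :: comm_ring_1)"
proof -
  let ?A = "Matrix.mat 2 2 f"
  have "Determinant.det ?A = (\<Sum>i<2. ?A $$ (i, 0) * cofactor ?A i 0)"
    by (rule laplace_expansion_column) auto
  moreover have "cofactor ?A 0 0 = f (1, 1)" "cofactor ?A 1 0 = - f (0, 1)"
    by (auto simp: cofactor_def mat_delete_def det_single)
  ultimately show ?thesis
    by (simp add: numeral_2_eq_2)
qed

text \<open>Updating one coordinate restricts \<open>F\<close> to a coordinate line; the chain rule
  along the two lines gives the columns of the matrix.\<close>

lemma jacobian_det_lin2: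
  assumes F: "((\<lambda>p. to_pair (F (of_pair p))) has_derivative lin2 a b c d) (at p)"
  shows "jacobian_det 2 F (of_pair p) = a * d - b * c"
proof -
  have "((\<lambda>\<zeta>. (\<zeta>, snd p)) has_derivative (\<lambda>h. (h, 0))) (at (fst p))"
    "((\<lambda>\<zeta>. (fst p, \<zeta>)) has_derivative (\<lambda>h. (0, h))) (at (snd p))"
    by (auto intro!: derivative_eq_intros)
  from diff_chain_at[OF this(1), of "\<lambda>p. to_pair (F (of_pair p))" "lin2 a b c d"]
    diff_chain_at[OF this(2), of "\<lambda>p. to_pair (F (of_pair p))" "lin2 a b c d"] F
  have 0: "((\<lambda>\<zeta>. to_pair (F (of_pair (\<zeta>, snd p)))) has_derivative (\<lambda>h. (a * h, c * h))) (at (fst p))"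
    and 1: "((\<lambda>\<zeta>. to_pair (F (of_pair (fst p, \<zeta>)))) has_derivative (\<lambda>h. (b * h, d * h))) (at (snd p))"
    by (simp_all add: o_def lin2_def)
  have "deriv (\<lambda>\<zeta>. F (of_pair (\<zeta>, snd p)) 0) (fst p) = a" "deriv (\<lambda>\<zeta>. F (of_pair (\<zeta>, snd p)) 1) (fst p) = c"
    using has_derivative_fst[OF 0] has_derivative_snd[OF 0]
    by (auto simp: to_pair_def has_field_derivative_def intro!: DERIV_imp_deriv)
  moreover have "deriv (\<lambda>\<zeta>. F (of_pair (fst p, \<zeta>)) 0) (snd p) = b" "deriv (\<lambda>\<zeta>. F (of_pair (fst p, \<zeta>)) 1) (snd p) = d"
    using has_derivative_fst[OF 1] has_derivative_snd[OF 1]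
    by (auto simp: to_pair_def has_field_derivative_def intro!: DERIV_imp_deriv)
  ultimately show ?thesis
    by (simp add: jacobian_det_def det_mat_2 of_pair_upd_0 of_pair_upd_1)
qed

lemma Cn_holomorphic_map_has_derivative:
  assumes "Cn_holomorphic_map 2 D F" "of_pair p \<in> D"
  shows "\<exists>a b c d. ((\<lambda>p. to_pair (F (of_pair p))) has_derivative lin2 a b c d) (at p)"
proof -
  have "Cn_differentiable 2 (\<lambda>z. F z 0) (of_pair p)" "Cn_differentiable 2 (\<lambda>z. F z 1) (of_pair p)"
    using assms by (auto simp: Cn_holomorphic_map_def Cn_holomorphic_def)
  then obtain a b c d where
    "((\<lambda>q. F (of_pair q) 0) has_derivative (\<lambda>h. a * fst h + b * snd h)) (at p)"
    "((\<lambda>q. F (of_pair q) 1) has_derivative (\<lambda>h. c * fst h + d * snd h)) (at p)"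
    unfolding Cn_differentiable_of_pair by blast
  from has_derivative_Pair[OF this] show ?thesis
    unfolding to_pair_def lin2_def[abs_def] by blast
qed

lemma Cn_domain_subset_topspace: "Cn_domain n D \<Longrightarrow> D \<subseteq> topspace (Cn_top n)"
  by (auto simp: Cn_domain_def dest: openin_subset)

lemma hartogs_not_circular_image:
  assumes D: "Cn_domain 2 D" "circular 2 D" and F: "biholomorphic_map 2 D Cn_hartogs_dom F"
    and J: "\<And>z. z \<in> D \<Longrightarrow> jacobian_det 2 F z = c"
  shows False
proof -
  define F' where "F' p = to_pair (F (of_pair p))" for p
  define G where "G = the_inv_into D F"
  define G' where "G' p = to_pair (G (of_pair p))" for p
  have bij: "bij_betw F D Cn_hartogs_dom" and holF: "Cn_holomorphic_map 2 D F"
    and holG: "Cn_holomorphic_map 2 Cn_hartogs_dom G"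
    using F by (auto simp: biholomorphic_map_def G_def)
  note Dtop = Cn_domain_subset_topspace[OF D(1)]
  have inj: "inj_on F D" and img: "F ` D = Cn_hartogs_dom"
    using bij by (auto simp: bij_betw_def)
  have FG: "F (G w) = w" "G w \<in> D" if "w \<in> Cn_hartogs_dom" for w
    using f_the_inv_into_f[OF inj, of w] the_inv_into_into[OF inj, of w D] that img
    by (simp_all add: G_def)
  have GF: "G (F z) = z" "F z \<in> Cn_hartogs_dom" if "z \<in> D" for z
    using the_inv_into_f_f[OF inj that] that img by (auto simp: G_def)
  have htop: "w \<in> topspace (Cn_top 2)" if "w \<in> Cn_hartogs_dom" for w
    using that by (auto simp: Cn_hartogs_dom_def)
  have hmem: "of_pair p \<in> Cn_hartogs_dom \<longleftrightarrow> p \<in> hartogs_dom" for p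
    by (auto simp: Cn_hartogs_dom_def)
  show False
  proof (rule hartogs_dom_not_circular_image[of "of_pair -` D" F' G' c])
    fix x assume x: "x \<in> of_pair -` D"
    then have x: "of_pair x \<in> D" by simp
    show "F' x \<in> hartogs_dom"
      using GF[OF x] htop by (simp add: F'_def flip: hmem)
    show "G' (F' x) = x"
      using GF[OF x] htop by (simp add: F'_def G'_def)
    have "(\<lambda>i\<in>{..<2}. \<i> * of_pair x i) \<in> D"
      using D(2) x by (simp add: circular_def)
    moreover have "(\<lambda>i\<in>{..<2}. \<i> * of_pair x i) = of_pair (cscale \<i> x)"
      by (auto simp: of_pair_def cscale_def)
    ultimately show "cscale \<i> x \<in> of_pair -` D" by simp
    show "has_cdet F' x c"
      using Cn_holomorphic_map_has_derivative[OF holF x] jacobian_det_lin2[of F] J[OF x]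
      unfolding has_cdet_def F'_def[abs_def] by metis
  next
    fix y assume "y \<in> hartogs_dom"
    then have y: "of_pair y \<in> Cn_hartogs_dom" by (simp add: hmem)
    show "G' y \<in> of_pair -` D"
      using FG[OF y] Dtop by (auto simp: G'_def)
    show "F' (G' y) = y"
      using FG[OF y] Dtop by (auto simp: F'_def G'_def)
    show "\<exists>\<delta>. has_cdet G' y \<delta>"
      using Cn_holomorphic_map_has_derivative[OF holG y]
      unfolding has_cdet_def G'_def[abs_def] by metis
  qed
qed

theorem proposition4p4:
  "\<exists>n\<ge>2. \<exists>\<Omega>. one_point_QDP n \<Omega> \<and>
     \<not> (\<exists>D F. Cn_domain n D \<and> circular n D \<and> biholomorphic_map n D \<Omega> F \<and>
            (\<exists>c. \<forall>z\<in>D. jacobian_det n F z = c))"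
proof (intro exI conjI notI)
  show "one_point_QDP 2 Cn_hartogs_dom" by (rule one_point_QDP_hartogs)
  assume "\<exists>D F. Cn_domain 2 D \<and> circular 2 D \<and> biholomorphic_map 2 D Cn_hartogs_dom F \<and>
            (\<exists>c. \<forall>z\<in>D. jacobian_det 2 F z = c)"
  then show False using hartogs_not_circular_image by blast
qed simp

end
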